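(* Let $(X,d,\alpha)$ be a computable metric space. Let $S$ be a semi-computable compact set in this space and suppose $x\in S$ is a point which has a neighborhood in $S$ homeomorphic to $\mathbb R^n$ for some $n\in\mathbb N$. Then there exists a neighborhood of $x$ in $S$ which is computable up to $S$.
   Context: A computable metric space is a triple $(X,d,\alpha)$ where $(X,d)$ is a metric space and $\alpha=(\alpha_i)_{i\in\mathbb N}$ is a sequence with dense range in $(X,d)$ such that $(i,j)\mapsto d(\alpha_i,\alpha_j)$ is a computable function $\mathbb N^2\to\mathbb R$ (a function $g:\mathbb N^k\to\mathbb R$ is computable if there is a computable $G:\mathbb N^{k+1}\to\mathbb Q$ with $|g(x)-G(x,i)|<2^{-i}$ for all $x,i$). Fix a computable $q:\mathbb N\to\mathbb Q$ whose image is the set of positive rationals and computable $\tau_1,\tau_2:\mathbb N\to\mathbb N$ with $\{(\tau_1(i),\tau_2(i)):i\in\mathbb N\}=\mathbb N^2$; let $\lambda_i=\alpha_{\tau_1(i)}$, $\rho_i=q_{\tau_2(i)}$, $I_i=B(\lambda_i,\rho_i)$ (open ball). Fix computable $\sigma:\mathbb N^2\to\mathbb N$, $\eta:\mathbb N\to\mathbb N$ such that $\{(\sigma(j,0),\dots,\sigma(j,\eta(j))):j\in\mathbb N\}$ is the set of all nonempty finite sequences in $\mathbb N$; let $[j]=\{\sigma(j,i):0\le i\le\eta(j)\}$, $J_j=\bigcup_{i\in[j]}I_i$ and $\Lambda_j=\{\alpha_i:i\in[j]\}$. A set $K\subseteq X$ is a semi-computable compact set if $K$ is compact in $(X,d)$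 and $\{j\in\mathbb N: K\subseteq J_j\}$ is computably enumerable. For $A,B\subseteq X$ and $\varepsilon>0$ write $A\prec_\varepsilon B$ if for each $a\in A$ there is $b\in B$ with $d(a,b)<\varepsilon$. For $A\subseteq B\subseteq X$, $A$ is computable up to $B$ if there is a computable $f:\mathbb N\to\mathbb N$ with $A\prec_{2^{-k}}\Lambda_{f(k)}$ and $\Lambda_{f(k)}\prec_{2^{-k}}B$ for all $k$. A neighborhood of $x$ in $S$ is a subset of $S$ containing $x$ in its interior relative to $S$. *)

theory Defs
  imports "HOL-Analysis.Analysis"
begin

datatype recf =
    Zero
  | Succ
  | Proj nat
  | Comp recf "recf list"
  | Prec recf recf
  | Mn recf

inductive evalr :: "recf \<Rightarrow> nat list \<Rightarrow> nat \<Rightarrow> bool" where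
  ev_zero: "evalr Zero xs 0"
| ev_succ: "evalr Succ (x # xs) (Suc x)"
| ev_proj: "i < length xs \<Longrightarrow> evalr (Proj i) xs (xs ! i)"
| ev_comp: "length ys = length gs \<Longrightarrow> (\<forall>i<length gs. evalr (gs ! i) xs (ys ! i))
            \<Longrightarrow> evalr f ys z \<Longrightarrow> evalr (Comp f gs) xs z"
| ev_prec0: "evalr f xs z \<Longrightarrow> evalr (Prec f g) (0 # xs) z"
| ev_precS: "evalr (Prec f g) (n # xs) y \<Longrightarrow> evalr g (n # y # xs) z
            \<Longrightarrow> evalr (Prec f g) (Suc n # xs) z"
| ev_mn: "evalr f (n # xs) 0 \<Longrightarrow> (\<forall>m<n. \<exists>y. evalr f (m # xs) y \<and> y \<noteq> 0)
            \<Longrightarrow> evalr (Mn f) xs n"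

definition rec_fn :: "nat \<Rightarrow> (nat list \<Rightarrow> nat) \<Rightarrow> bool" where
  "rec_fn k f \<longleftrightarrow> (\<exists>p. \<forall>xs. length xs = k \<longrightarrow> evalr p xs (f xs))"

definition computable1 :: "(nat \<Rightarrow> nat) \<Rightarrow> bool" where
  "computable1 f \<longleftrightarrow> rec_fn 1 (\<lambda>xs. f (xs ! 0))"

definition computable2 :: "(nat \<Rightarrow> nat \<Rightarrow> nat) \<Rightarrow> bool" where
  "computable2 f \<longleftrightarrow> rec_fn 2 (\<lambda>xs. f (xs ! 0) (xs ! 1))"

definition rec_rat_fn :: "nat \<Rightarrow> (nat list \<Rightarrow> rat) \<Rightarrow> bool" where
  "rec_rat_fn k G \<longleftrightarrow> (\<exists>a b c. rec_fn k a \<and> rec_fn k b \<and> rec_fn k c \<and>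
      (\<forall>xs. length xs = k \<longrightarrow> G xs = (of_nat (a xs) - of_nat (b xs)) / of_nat (c xs + 1)))"

definition rec_real_fn :: "nat \<Rightarrow> (nat list \<Rightarrow> real) \<Rightarrow> bool" where
  "rec_real_fn k g \<longleftrightarrow> (\<exists>G. rec_rat_fn (Suc k) G \<and>
      (\<forall>xs i. length xs = k \<longrightarrow> \<bar>g xs - real_of_rat (G (xs @ [i]))\<bar> < (1/2) ^ i))"

definition ce_set :: "nat set \<Rightarrow> bool" where
  "ce_set A \<longleftrightarrow> (\<exists>p. A = {x. \<exists>y. evalr p [x] y})"

definition computable_metric_space :: "(nat \<Rightarrow> 'a::metric_space) \<Rightarrow> bool" where
  "computable_metric_space \<alpha> \<longleftrightarrow> closure (range \<alpha>) = UNIV \<and>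
     rec_real_fn 2 (\<lambda>xs. dist (\<alpha> (xs ! 0)) (\<alpha> (xs ! 1)))"

definition good_enumerations ::
  "(nat \<Rightarrow> rat) \<Rightarrow> (nat \<Rightarrow> nat) \<Rightarrow> (nat \<Rightarrow> nat) \<Rightarrow> (nat \<Rightarrow> nat \<Rightarrow> nat) \<Rightarrow> (nat \<Rightarrow> nat) \<Rightarrow> bool" where
  "good_enumerations q \<tau>1 \<tau>2 \<sigma> \<eta> \<longleftrightarrow>
     rec_rat_fn 1 (\<lambda>xs. q (xs ! 0)) \<and> range q = {r. r > 0} \<and>
     computable1 \<tau>1 \<and> computable1 \<tau>2 \<and> range (\<lambda>i. (\<tau>1 i, \<tau>2 i)) = UNIV \<and>
     computable2 \<sigma> \<and> computable1 \<eta> \<and>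
     range (\<lambda>j. map (\<sigma> j) [0..<Suc (\<eta> j)]) = {l. l \<noteq> []}"

definition ball_I :: "(nat \<Rightarrow> 'a::metric_space) \<Rightarrow> (nat \<Rightarrow> rat) \<Rightarrow> (nat \<Rightarrow> nat) \<Rightarrow> (nat \<Rightarrow> nat) \<Rightarrow> nat \<Rightarrow> 'a set" where
  "ball_I \<alpha> q \<tau>1 \<tau>2 i = ball (\<alpha> (\<tau>1 i)) (real_of_rat (q (\<tau>2 i)))"

definition idx :: "(nat \<Rightarrow> nat \<Rightarrow> nat) \<Rightarrow> (nat \<Rightarrow> nat) \<Rightarrow> nat \<Rightarrow> nat set" where
  "idx \<sigma> \<eta> j = {\<sigma> j i | i. i \<le> \<eta> j}"

definition union_J :: "(nat \<Rightarrow> 'a::metric_space) \<Rightarrow> (nat \<Rightarrow> rat) \<Rightarrow> (nat \<Rightarrow> nat) \<Rightarrow> (nat \<Rightarrow> nat)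
    \<Rightarrow> (nat \<Rightarrow> nat \<Rightarrow> nat) \<Rightarrow> (nat \<Rightarrow> nat) \<Rightarrow> nat \<Rightarrow> 'a set" where
  "union_J \<alpha> q \<tau>1 \<tau>2 \<sigma> \<eta> j = (\<Union>i\<in>idx \<sigma> \<eta> j. ball_I \<alpha> q \<tau>1 \<tau>2 i)"

definition Lam :: "(nat \<Rightarrow> 'a) \<Rightarrow> (nat \<Rightarrow> nat \<Rightarrow> nat) \<Rightarrow> (nat \<Rightarrow> nat) \<Rightarrow> nat \<Rightarrow> 'a set" where
  "Lam \<alpha> \<sigma> \<eta> j = \<alpha> ` idx \<sigma> \<eta> j"

definition semicomputable_compact :: "(nat \<Rightarrow> 'a::metric_space) \<Rightarrow> (nat \<Rightarrow> rat) \<Rightarrow> (nat \<Rightarrow> nat)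
    \<Rightarrow> (nat \<Rightarrow> nat) \<Rightarrow> (nat \<Rightarrow> nat \<Rightarrow> nat) \<Rightarrow> (nat \<Rightarrow> nat) \<Rightarrow> 'a set \<Rightarrow> bool" where
  "semicomputable_compact \<alpha> q \<tau>1 \<tau>2 \<sigma> \<eta> K \<longleftrightarrow>
     compact K \<and> ce_set {j. K \<subseteq> union_J \<alpha> q \<tau>1 \<tau>2 \<sigma> \<eta> j}"

definition prec_eps :: "'a::metric_space set \<Rightarrow> real \<Rightarrow> 'a set \<Rightarrow> bool" where
  "prec_eps A \<epsilon> B \<longleftrightarrow> (\<forall>a\<in>A. \<exists>b\<in>B. dist a b < \<epsilon>)"

definition computable_up_to :: "(nat \<Rightarrow> 'a::metric_space) \<Rightarrow> (nat \<Rightarrow> nat \<Rightarrow> nat) \<Rightarrow> (nat \<Rightarrow> nat)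
    \<Rightarrow> 'a set \<Rightarrow> 'a set \<Rightarrow> bool" where
  "computable_up_to \<alpha> \<sigma> \<eta> A B \<longleftrightarrow> (\<exists>f. computable1 f \<and>
     (\<forall>k. prec_eps A ((1/2) ^ k) (Lam \<alpha> \<sigma> \<eta> (f k)) \<and>
          prec_eps (Lam \<alpha> \<sigma> \<eta> (f k)) ((1/2) ^ k) B))"

definition nbhd_in :: "'a::topological_space set \<Rightarrow> 'a \<Rightarrow> 'a set \<Rightarrow> bool" where
  "nbhd_in S x N \<longleftrightarrow> N \<subseteq> S \<and> x \<in> (top_of_set S) interior_of N"

end

theory Submission
  imports Defs
begin

text \<open>Let \<open>h\<close> embed the cube \<open>[-2, 2]\<^sup>n\<close> into \<open>S\<close> with \<open>h 0 = x\<close>, mapping concentric open cubes to open subsets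
  of \<open>S\<close>. That a rational ball \<open>B\<close> meets \<open>S\<close> near \<open>x\<close> is certified by a finite cover of \<open>S\<close> by rational balls
  in which every ball not lying formally inside \<open>B\<close> either avoids the unit cube or is assigned to the
  negative or positive side of some axis, opposite sides being formally disjoint and containing fixed
  neighbourhoods of opposite faces. By Poincare--Miranda the sides do not cover the unit cube, so some
  ball inside \<open>B\<close> meets \<open>S\<close>; conversely a small cube around a point of \<open>B\<close> in the range of \<open>h\<close> yields such
  a cover. As covers of \<open>S\<close> and strict inequalities between distances are semidecidable, one can search
  for a finite set of certified centres whose \<open>2\<^sup>-\<^sup>k\<close>-balls, together with finitely many fixed balls off
  the small cube \<open>h [-1/4, 1/4]\<^sup>n\<close>, cover \<open>S\<close>. Existential, bounded universal and recursive
  definitions preserve semidecidability because \<open>\<sigma>\<close> codes finite sequences and \<open>\<tau>1\<close>, \<open>\<tau>2\<close> code pairs.\<close>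


text \<open>The obstacle is that the hypothesis on \<open>S\<close> gives information from above
  only: covers of \<open>S\<close> are eventually confirmed, but nothing directly confirms that a
  given ball meets \<open>S\<close>. Topology has to supply this lower information. The map
  \<open>h\<close> enters the search only through the dimension and the finite index sets
  \<open>W\<close>, \<open>W'\<close> and \<open>F\<close>, fixed once for all precisions
  \<open>k\<close>; this is why an arbitrary homeomorphism suffices. "Formally" refers to strict
  inequalities between radii and distances of centres. They imply the inclusion or disjointness of
  the balls and, unlike these, can be confirmed by computation. The half-widths
  \<open>1/4 < 1/2 < 1 < 3/2 < 2\<close> leave room at every stage: points of the
  \<open>1/4\<close>-cube are approximated by centres near the \<open>1/2\<close>-cube; such a
  centre is certified against the faces of the unit cube, which lie at coordinate distance at least
  \<open>1/2\<close>; the balls of \<open>W\<close> cover what lies outside the open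
  \<open>3/2\<close>-cube and so can avoid the unit cube; the chart itself lives on the
  \<open>2\<close>-cube.\<close>

section \<open>Closure properties of total recursive functions\<close>

lemma rec_fn_cong:
  assumes "rec_fn k f" "\<And>xs. length xs = k \<Longrightarrow> f xs = g xs"
  shows "rec_fn k g"
  using assms unfolding rec_fn_def by metis

lemma rec_fn_proj: "i < k \<Longrightarrow> rec_fn k (\<lambda>xs. xs ! i)"
  unfolding rec_fn_def by (metis ev_proj)

lemma rec_fn_comp:
  assumes f: "rec_fn (length gs) f" and gs: "\<And>g. g \<in> set gs \<Longrightarrow> rec_fn k g"
  shows "rec_fn k (\<lambda>xs. f (map (\<lambda>g. g xs) gs))"
proof -
  obtain p where p: "\<And>xs. length xs = length gs \<Longrightarrow> evalr p xs (f xs)"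
    using f unfolding rec_fn_def by blast
  obtain r where r: "\<And>g xs. g \<in> set gs \<Longrightarrow> length xs = k \<Longrightarrow> evalr (r g) xs (g xs)"
    using gs unfolding rec_fn_def by metis
  have "evalr (Comp p (map r gs)) xs (f (map (\<lambda>g. g xs) gs))" if "length xs = k" for xs
    by (rule ev_comp[of "map (\<lambda>g. g xs) gs"]) (use that r p in auto)
  then show ?thesis unfolding rec_fn_def by blast
qed

lemma rec_fn_comp1: "rec_fn 1 f \<Longrightarrow> rec_fn k g \<Longrightarrow> rec_fn k (\<lambda>xs. f [g xs])"
  using rec_fn_comp[of "[g]" f k] by simp

lemma rec_fn_comp2: "rec_fn 2 f \<Longrightarrow> rec_fn k g \<Longrightarrow> rec_fn k h \<Longrightarrow> rec_fn k (\<lambda>xs. f [g xs, h xs])"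
  using rec_fn_comp[of "[g, h]" f k] by (auto simp: numeral_2_eq_2)

text \<open>Variables are kept in lists with the innermost quantified one in front. Recomputing a
  front segment while projections pass on the other \<open>k\<close> arguments therefore covers
  weakening, substitution and the decoding of pairs.\<close>

lemma rec_fn_prefix:
  assumes f: "rec_fn (length gs + k) f" and gs: "\<And>g. g \<in> set gs \<Longrightarrow> rec_fn (m + k) g"
  shows "rec_fn (m + k) (\<lambda>xs. f (map (\<lambda>g. g xs) gs @ drop m xs))"
proof -
  let ?hs = "gs @ map (\<lambda>i xs. xs ! (m + i)) [0..<k]"
  have "rec_fn (m + k) (\<lambda>xs. f (map (\<lambda>g. g xs) ?hs))"
    by (rule rec_fn_comp) (use assms rec_fn_proj in auto)
  then show ?thesis
  proof (rule rec_fn_cong)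
    fix xs :: "nat list" assume "length xs = m + k"
    then have "map (\<lambda>g. g xs) (map (\<lambda>i xs. xs ! (m + i)) [0..<k]) = drop m xs"
      by (auto intro!: nth_equalityI)
    then show "f (map (\<lambda>g. g xs) ?hs) = f (map (\<lambda>g. g xs) gs @ drop m xs)" by simp
  qed
qed

lemma rec_fn_cons: "rec_fn (Suc k) f \<Longrightarrow> rec_fn k g \<Longrightarrow> rec_fn k (\<lambda>xs. f (g xs # xs))"
  using rec_fn_prefix[of "[g]" k f 0] by simp

lemma rec_fn_tl: "rec_fn k f \<Longrightarrow> rec_fn (Suc k) (\<lambda>xs. f (tl xs))"
  using rec_fn_prefix[of "[]" k f 1] by (simp add: drop_Suc)

lemma rec_fn_zero: "rec_fn k (\<lambda>xs. 0)"
  unfolding rec_fn_def by (metis ev_zero)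

lemma rec_fn_Suc:
  assumes "rec_fn k f" shows "rec_fn k (\<lambda>xs. Suc (f xs))"
proof -
  have "rec_fn 1 (\<lambda>xs. Suc (xs ! 0))"
    unfolding rec_fn_def
  proof (intro exI allI impI)
    fix xs :: "nat list" assume "length xs = 1"
    then show "evalr Succ xs (Suc (xs ! 0))" by (cases xs) (auto intro: ev_succ)
  qed
  from rec_fn_comp1[OF this assms] show ?thesis by simp
qed

lemma rec_fn_const: "rec_fn k (\<lambda>xs. c)"
  by (induction c) (auto intro: rec_fn_zero rec_fn_Suc)

lemma rec_fn_rec_nat:
  assumes "rec_fn k f" "rec_fn (Suc (Suc k)) g"
  shows "rec_fn (Suc k) (\<lambda>xs. rec_nat (f (tl xs)) (\<lambda>n y. g (n # y # tl xs)) (hd xs))"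
proof -
  obtain p where p: "\<And>xs. length xs = k \<Longrightarrow> evalr p xs (f xs)"
    using assms unfolding rec_fn_def by blast
  obtain r where r: "\<And>xs. length xs = Suc (Suc k) \<Longrightarrow> evalr r xs (g xs)"
    using assms unfolding rec_fn_def by blast
  have *: "evalr (Prec p r) (n # ys) (rec_nat (f ys) (\<lambda>n y. g (n # y # ys)) n)" if "length ys = k" for n ys
  proof (induction n)
    case 0
    then show ?case using p[OF that] by (simp add: ev_prec0)
  next
    case (Suc n)
    then show ?case using that by (auto intro!: ev_precS r)
  qed
  have "evalr (Prec p r) xs (rec_nat (f (tl xs)) (\<lambda>n y. g (n # y # tl xs)) (hd xs))"
    if "length xs = Suc k" for xs
    using *[of "tl xs" "hd xs"] that by (cases xs) auto
  then show ?thesis unfolding rec_fn_def by blast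
qed

lemma rec_fn_rec_nat':
  assumes "rec_fn k m" "rec_fn k f" "rec_fn (Suc (Suc k)) g"
  shows "rec_fn k (\<lambda>xs. rec_nat (f xs) (\<lambda>n y. g (n # y # xs)) (m xs))"
  using rec_fn_cons[OF rec_fn_rec_nat[OF assms(2,3)] assms(1)] by simp

lemma rec_fn_add:
  assumes "rec_fn k f" "rec_fn k g" shows "rec_fn k (\<lambda>xs. f xs + g xs)"
proof -
  have *: "rec_nat b (\<lambda>n y. Suc y) a = a + b" for a b :: nat by (induction a) auto
  have "rec_fn k (\<lambda>xs. rec_nat (g xs) (\<lambda>n y. Suc ((n # y # xs) ! 1)) (f xs))"
    by (rule rec_fn_rec_nat'[OF assms]) (auto intro: rec_fn_Suc rec_fn_proj)
  then show ?thesis by (simp add: *)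
qed

lemma rec_fn_mult:
  assumes "rec_fn k f" "rec_fn k g" shows "rec_fn k (\<lambda>xs. f xs * g xs)"
proof -
  have *: "rec_nat 0 (\<lambda>n y. y + b) a = a * b" for a b :: nat by (induction a) auto
  have "rec_fn k (\<lambda>xs. rec_nat 0 (\<lambda>n y. (n # y # xs) ! 1 + g (tl (tl (n # y # xs)))) (f xs))"
    by (rule rec_fn_rec_nat'[OF assms(1) rec_fn_zero])
       (intro rec_fn_add rec_fn_proj rec_fn_tl assms rec_fn_tl[of _ "\<lambda>xs. g (tl xs)"]; simp)
  then show ?thesis by (simp add: *)
qed

lemma rec_fn_power:
  assumes "rec_fn k f" shows "rec_fn k (\<lambda>xs. c ^ f xs)"
proof -
  have *: "rec_nat 1 (\<lambda>n y. c * y) a = c ^ a" for a :: nat by (induction a) auto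
  have "rec_fn k (\<lambda>xs. rec_nat 1 (\<lambda>n y. c * (n # y # xs) ! 1) (f xs))"
    by (rule rec_fn_rec_nat'[OF assms(1) rec_fn_const])
       (intro rec_fn_mult rec_fn_proj rec_fn_const; simp)
  then show ?thesis by (simp add: *[simplified])
qed

lemma rec_fn_pred:
  assumes "rec_fn k f" shows "rec_fn k (\<lambda>xs. f xs - 1)"
proof -
  have *: "rec_nat 0 (\<lambda>n y. n) a = a - 1" for a :: nat by (cases a) auto
  have "rec_fn k (\<lambda>xs. rec_nat 0 (\<lambda>n y. (n # y # xs) ! 0) (f xs))"
    by (rule rec_fn_rec_nat'[OF assms(1) rec_fn_const]) (rule rec_fn_proj; simp)
  then show ?thesis by (simp add: *)
qed

lemma rec_fn_diff:
  assumes "rec_fn k f" "rec_fn k g" shows "rec_fn k (\<lambda>xs. f xs - g xs)"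
proof -
  have *: "rec_nat b (\<lambda>n y. y - 1) a = b - a" for a b :: nat by (induction a) auto
  have "rec_fn k (\<lambda>xs. rec_nat (f xs) (\<lambda>n y. (n # y # xs) ! 1 - 1) (g xs))"
    by (rule rec_fn_rec_nat'[OF assms(2,1)]) (intro rec_fn_pred rec_fn_proj; simp)
  then show ?thesis by (simp add: *[simplified])
qed

lemma computable1_comp: "computable1 f \<Longrightarrow> rec_fn k g \<Longrightarrow> rec_fn k (\<lambda>xs. f (g xs))"
  unfolding computable1_def using rec_fn_comp1[of "\<lambda>xs. f (xs ! 0)" k g] by simp

lemma computable2_comp:
  "computable2 f \<Longrightarrow> rec_fn k g \<Longrightarrow> rec_fn k h \<Longrightarrow> rec_fn k (\<lambda>xs. f (g xs) (h xs))"
  unfolding computable2_def using rec_fn_comp2[of "\<lambda>xs. f (xs ! 0) (xs ! 1)" k g h] by simp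

section \<open>Decidable and semidecidable predicates\<close>

definition decidable :: "nat \<Rightarrow> (nat list \<Rightarrow> bool) \<Rightarrow> bool" where
  "decidable k P \<longleftrightarrow> rec_fn k (\<lambda>xs. of_bool (P xs))"

lemma decidable_cong:
  assumes "decidable k P" "\<And>xs. length xs = k \<Longrightarrow> P xs = Q xs"
  shows "decidable k Q"
  using assms unfolding decidable_def by (auto elim: rec_fn_cong)

lemma decidable_not: "decidable k P \<Longrightarrow> decidable k (\<lambda>xs. \<not> P xs)"
  unfolding decidable_def
  by (drule rec_fn_diff[OF rec_fn_const[of k 1]]) (auto elim!: rec_fn_cong)

lemma decidable_conj: "decidable k P \<Longrightarrow> decidable k Q \<Longrightarrow> decidable k (\<lambda>xs. P xs \<and> Q xs)"
  unfolding decidable_def by (drule (1) rec_fn_mult) (simp only: of_bool_conj)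

lemma decidable_disj: "decidable k P \<Longrightarrow> decidable k Q \<Longrightarrow> decidable k (\<lambda>xs. P xs \<or> Q xs)"
  using decidable_not[OF decidable_conj[OF decidable_not decidable_not]] by simp

lemma decidable_const: "decidable k (\<lambda>xs. b)"
  unfolding decidable_def by (rule rec_fn_const)

lemma decidable_le:
  assumes "rec_fn k f" "rec_fn k g" shows "decidable k (\<lambda>xs. f xs \<le> g xs)"
proof -
  have "rec_fn k (\<lambda>xs. 1 - (f xs - g xs))" by (intro rec_fn_diff rec_fn_const assms)
  then show ?thesis unfolding decidable_def by (rule rec_fn_cong) auto
qed

lemma decidable_less: "rec_fn k f \<Longrightarrow> rec_fn k g \<Longrightarrow> decidable k (\<lambda>xs. f xs < g xs)"
  using decidable_not[OF decidable_le[of k g f]] by (simp add: not_le)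

lemma decidable_eq: "rec_fn k f \<Longrightarrow> rec_fn k g \<Longrightarrow> decidable k (\<lambda>xs. f xs = g xs)"
  using decidable_conj[OF decidable_le[of k f g] decidable_le[of k g f]] by (simp add: eq_iff)

lemma decidable_prefix:
  assumes "decidable (length gs + k) P" "\<And>g. g \<in> set gs \<Longrightarrow> rec_fn (m + k) g"
  shows "decidable (m + k) (\<lambda>xs. P (map (\<lambda>g. g xs) gs @ drop m xs))"
  using assms unfolding decidable_def by (rule rec_fn_prefix)

text \<open>The truth value is a product of characteristic values, computed by primitive recursion
  up to \<open>Suc (f xs)\<close>.\<close>

lemma decidable_all_le:
  assumes P: "decidable (Suc k) P" and f: "rec_fn k f"
  shows "decidable k (\<lambda>xs. \<forall>i\<le>f xs. P (i # xs))"
proof -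
  have *: "rec_nat 1 (\<lambda>n y. y * of_bool (p n)) m = (of_bool (\<forall>i<m. p i) :: nat)" for p m
    by (induction m) (auto simp: less_Suc_eq)
  \<comment> \<open>The recursion step receives the counter, the accumulator and then
    \<open>xs\<close>; this selection skips the accumulator.\<close>
  let ?gs = "(\<lambda>xs. xs ! 0) # map (\<lambda>i xs. xs ! Suc (Suc i)) [0..<k]"
  have "rec_fn (Suc (Suc k)) (\<lambda>xs. of_bool (P (map (\<lambda>g. g xs) ?gs)))"
    by (rule rec_fn_comp) (use assms rec_fn_proj in \<open>auto simp: decidable_def\<close>)
  then have "rec_fn k (\<lambda>xs. rec_nat 1 (\<lambda>n y. (n # y # xs) ! 1 * of_bool (P (map (\<lambda>g. g (n # y # xs)) ?gs))) (Suc (f xs)))"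
    by (intro rec_fn_rec_nat'[where g = "\<lambda>xs. xs ! 1 * of_bool (P (map (\<lambda>g. g xs) ?gs))"] rec_fn_const rec_fn_Suc f rec_fn_mult rec_fn_proj) auto
  then show ?thesis
    unfolding decidable_def
  proof (rule rec_fn_cong)
    fix xs :: "nat list" assume xs: "length xs = k"
    then have "map (\<lambda>g. g (n # y # xs)) ?gs = n # xs" for n y
      using map_nth[of xs] by (simp add: comp_def)
    then show "rec_nat 1 (\<lambda>n y. (n # y # xs) ! 1 * of_bool (P (map (\<lambda>g. g (n # y # xs)) ?gs))) (Suc (f xs))
      = of_bool (\<forall>i\<le>f xs. P (i # xs))"
      using *[of "\<lambda>n. P (n # xs)" "Suc (f xs)"] by (simp only: less_Suc_eq_le) simp
  qed
qed


lemma rec_fn_Least: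
  assumes D: "decidable (Suc k) D" and ex: "\<And>xs. length xs = k \<Longrightarrow> \<exists>t. D (t # xs)"
  shows "rec_fn k (\<lambda>xs. LEAST t. D (t # xs))"
proof -
  \<comment> \<open>\<open>Mn\<close> searches for a zero, hence the negation.\<close>
  have "rec_fn (Suc k) (\<lambda>xs. of_bool (\<not> D xs))"
    using decidable_not[OF D] by (simp add: decidable_def)
  then obtain p where p: "\<And>xs. length xs = Suc k \<Longrightarrow> evalr p xs (of_bool (\<not> D xs))"
    unfolding rec_fn_def by blast
  have "evalr (Mn p) xs (LEAST t. D (t # xs))" if xs: "length xs = k" for xs
  proof (rule ev_mn)
    have "D ((LEAST t. D (t # xs)) # xs)" using ex[OF xs] by (rule LeastI_ex)
    then show "evalr p ((LEAST t. D (t # xs)) # xs) 0"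
      using p[of "(LEAST t. D (t # xs)) # xs"] xs by simp
    show "\<forall>m<LEAST t. D (t # xs). \<exists>y. evalr p (m # xs) y \<and> y \<noteq> 0"
    proof (intro allI impI exI conjI)
      fix m assume "m < (LEAST t. D (t # xs))"
      then have "\<not> D (m # xs)" by (rule not_less_Least)
      then show "evalr p (m # xs) 1" using p[of "m # xs"] xs by simp
    qed simp
  qed
  then show ?thesis unfolding rec_fn_def by blast
qed

text \<open>The projection form of semidecidability, with the witness in front of the arguments. In
  contrast to the halting form used by \<open>ce_set\<close>, its closure properties reduce to
  coding several witnesses as one.\<close>

definition ce_pred :: "nat \<Rightarrow> (nat list \<Rightarrow> bool) \<Rightarrow> bool" where
  "ce_pred k P \<longleftrightarrow> (\<exists>D. decidable (Suc k) D \<and> (\<forall>xs. length xs = k \<longrightarrow> P xs = (\<exists>t. D (t # xs))))"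

lemma ce_pred_cong:
  assumes "ce_pred k P" "\<And>xs. length xs = k \<Longrightarrow> P xs = Q xs"
  shows "ce_pred k Q"
  using assms unfolding ce_pred_def by simp

lemma ce_pred_decidable:
  assumes "decidable k P" shows "ce_pred k P"
  using decidable_prefix[of "[]" k P 1] assms unfolding ce_pred_def
  by (intro exI[of _ "\<lambda>xs. P (tl xs)"]) (simp add: drop_Suc)

lemma ce_pred_disj:
  assumes "ce_pred k P" "ce_pred k Q" shows "ce_pred k (\<lambda>xs. P xs \<or> Q xs)"
proof -
  obtain D where D: "decidable (Suc k) D" "\<And>xs. length xs = k \<Longrightarrow> P xs = (\<exists>t. D (t # xs))"
    using assms(1) unfolding ce_pred_def by blast
  obtain E where E: "decidable (Suc k) E" "\<And>xs. length xs = k \<Longrightarrow> Q xs = (\<exists>t. E (t # xs))"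
    using assms(2) unfolding ce_pred_def by blast
  show ?thesis unfolding ce_pred_def
    by (intro exI[of _ "\<lambda>xs. D xs \<or> E xs"] conjI decidable_disj D(1) E(1)) (auto simp: D(2) E(2))
qed

lemma ce_pred_prefix:
  assumes P: "ce_pred (length gs + k) P" and gs: "\<And>g. g \<in> set gs \<Longrightarrow> rec_fn (m + k) g"
  shows "ce_pred (m + k) (\<lambda>xs. P (map (\<lambda>g. g xs) gs @ drop m xs))"
proof -
  obtain D where D: "decidable (Suc (length gs + k)) D"
      "\<And>xs. length xs = length gs + k \<Longrightarrow> P xs = (\<exists>t. D (t # xs))"
    using P unfolding ce_pred_def by blast
  \<comment> \<open>The search witness stays in front, so every substituted function reads the list
    behind it.\<close>
  let ?gs = "(\<lambda>xs. xs ! 0) # map (\<lambda>g xs. g (tl xs)) gs"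
  have "decidable (Suc m + k) (\<lambda>xs. D (map (\<lambda>g. g xs) ?gs @ drop (Suc m) xs))"
    by (rule decidable_prefix) (use D(1) gs rec_fn_tl rec_fn_proj in auto)
  then show ?thesis unfolding ce_pred_def
    by (intro exI[of _ "\<lambda>xs. D (map (\<lambda>g. g xs) ?gs @ drop (Suc m) xs)"])
       (auto simp: D(2) comp_def)
qed

lemma ce_pred_subst:
  assumes "ce_pred (length gs) P" "\<And>g. g \<in> set gs \<Longrightarrow> rec_fn k g"
  shows "ce_pred k (\<lambda>xs. P (map (\<lambda>g. g xs) gs))"
  using ce_pred_prefix[of gs 0 P k] assms by (auto elim!: ce_pred_cong)

lemma ce_pred_subst1: "ce_pred 1 (\<lambda>xs. P (xs ! 0)) \<Longrightarrow> rec_fn k f \<Longrightarrow> ce_pred k (\<lambda>xs. P (f xs))"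
  using ce_pred_subst[of "[f]" "\<lambda>xs. P (xs ! 0)" k] by simp

lemma ce_pred_evalr_prefix:
  assumes "\<And>k. ce_pred (Suc k) (\<lambda>xs. evalr p (tl xs) (hd xs))" "rec_fn (m + k) f"
    "\<And>g. g \<in> set gs \<Longrightarrow> rec_fn (m + k) g"
  shows "ce_pred (m + k) (\<lambda>xs. evalr p (map (\<lambda>g. g xs) gs @ drop m xs) (f xs))"
  using ce_pred_prefix[of "f # gs" k "\<lambda>xs. evalr p (tl xs) (hd xs)" m] assms by auto

section \<open>Inversion of program evaluation\<close>

lemma evalr_Zero_iff: "evalr Zero xs y \<longleftrightarrow> y = 0"
  by (auto elim: evalr.cases intro: ev_zero)

lemma evalr_Succ_iff: "evalr Succ (x # xs) y \<longleftrightarrow> y = Suc x" "\<not> evalr Succ [] y"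
  by (auto elim: evalr.cases intro: ev_succ)

lemma evalr_Proj_iff: "evalr (Proj i) xs y \<longleftrightarrow> i < length xs \<and> y = xs ! i"
  by (auto elim: evalr.cases intro: ev_proj)

lemma evalr_Comp_iff:
  "evalr (Comp f gs) xs y \<longleftrightarrow>
    (\<exists>ys. length ys = length gs \<and> (\<forall>i<length gs. evalr (gs ! i) xs (ys ! i)) \<and> evalr f ys y)"
  by (auto elim: evalr.cases intro: ev_comp)

lemma evalr_Mn_iff:
  "evalr (Mn f) xs n \<longleftrightarrow> evalr f (n # xs) 0 \<and> (\<forall>m<n. \<exists>y. evalr f (m # xs) y \<and> y \<noteq> 0)"
  by (auto elim: evalr.cases intro: ev_mn)

lemma evalr_Prec_Nil: "\<not> evalr (Prec f g) [] y"
  by (auto elim: evalr.cases)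

text \<open>The list \<open>ys\<close> is the trace of the recursion. A finite trace can be coded by
  a number through \<open>\<sigma>\<close>, which makes primitive recursion accessible to a
  search.\<close>

lemma evalr_Prec_iff:
  "evalr (Prec f g) (n # xs) y \<longleftrightarrow>
    (\<exists>ys. length ys = Suc n \<and> evalr f xs (ys ! 0) \<and>
      (\<forall>i<n. evalr g (i # ys ! i # xs) (ys ! Suc i)) \<and> ys ! n = y)" (is "_ \<longleftrightarrow> (\<exists>ys. ?C n y ys)")
proof
  show "evalr (Prec f g) (n # xs) y \<Longrightarrow> \<exists>ys. ?C n y ys"
  proof (induction n arbitrary: y)
    case 0
    then have "evalr f xs y" by (auto elim: evalr.cases)
    then show ?case by (intro exI[of _ "[y]"]) auto
  next
    case (Suc n)
    then obtain z where z: "evalr (Prec f g) (n # xs) z" "evalr g (n # z # xs) y"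
      by (auto elim: evalr.cases)
    from Suc.IH[OF z(1)] obtain ys where "?C n z ys" by blast
    then have "?C (Suc n) y (ys @ [y])" using z(2)
      by (auto simp: nth_append less_Suc_eq)
    then show ?case by blast
  qed
  show "\<exists>ys. ?C n y ys \<Longrightarrow> evalr (Prec f g) (n # xs) y"
  proof (induction n arbitrary: y)
    case 0
    then show ?case by (auto intro: ev_prec0)
  next
    case (Suc n)
    then obtain ys where ys: "?C (Suc n) y ys" by blast
    then have "?C n (ys ! n) (butlast ys)" by (auto simp: nth_butlast)
    then have "evalr (Prec f g) (n # xs) (ys ! n)" using Suc.IH by blast
    then show ?case using ys ev_precS by blast
  qed
qed

section \<open>Quantifiers over semidecidable predicates, with the given enumerations as
  codings\<close>

locale enumerations =
  fixes q :: "nat \<Rightarrow> rat" and \<tau>1 \<tau>2 :: "nat \<Rightarrow> nat" and \<sigma> :: "nat \<Rightarrow> nat \<Rightarrow> nat" and \<eta> :: "nat \<Rightarrow> nat"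
  assumes good: "good_enumerations q \<tau>1 \<tau>2 \<sigma> \<eta>"
begin

lemma rec_fn_\<tau>1: "rec_fn k f \<Longrightarrow> rec_fn k (\<lambda>xs. \<tau>1 (f xs))"
  and rec_fn_\<tau>2: "rec_fn k f \<Longrightarrow> rec_fn k (\<lambda>xs. \<tau>2 (f xs))"
  and rec_fn_\<eta>: "rec_fn k f \<Longrightarrow> rec_fn k (\<lambda>xs. \<eta> (f xs))"
  and rec_fn_\<sigma>: "rec_fn k f \<Longrightarrow> rec_fn k g \<Longrightarrow> rec_fn k (\<lambda>xs. \<sigma> (f xs) (g xs))"
  using good unfolding good_enumerations_def by (simp_all add: computable1_comp computable2_comp)

lemma \<tau>_surj: obtains s where "\<tau>1 s = a" "\<tau>2 s = b"
proof -
  have "(a, b) \<in> range (\<lambda>i. (\<tau>1 i, \<tau>2 i))" using good unfolding good_enumerations_def by simp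
  then show ?thesis using that by blast
qed

lemma \<sigma>_surj:
  assumes "l \<noteq> []" obtains c where "Suc (\<eta> c) = length l" "\<And>i. i < length l \<Longrightarrow> \<sigma> c i = l ! i"
proof -
  have "l \<in> range (\<lambda>j. map (\<sigma> j) [0..<Suc (\<eta> j)])"
    using good assms unfolding good_enumerations_def by simp
  then obtain c where "l = map (\<sigma> c) [0..<Suc (\<eta> c)]" by blast
  then have "Suc (\<eta> c) = length l" "\<And>i. i < length l \<Longrightarrow> \<sigma> c i = l ! i"
    by (auto simp del: upt_Suc)
  then show ?thesis by (rule that)
qed

text \<open>The quantified variable and the witness for it are found together, as the two components
  of one number \<open>s\<close>.\<close>

lemma ce_pred_ex:
  assumes "ce_pred (Suc k) P" shows "ce_pred k (\<lambda>xs. \<exists>t. P (t # xs))"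
proof -
  obtain D where D: "decidable (Suc (Suc k)) D" "\<And>xs. length xs = Suc k \<Longrightarrow> P xs = (\<exists>t. D (t # xs))"
    using assms unfolding ce_pred_def by blast
  let ?gs = "[\<lambda>xs. \<tau>1 (xs ! 0), \<lambda>xs. \<tau>2 (xs ! 0)]"
  have "decidable (1 + k) (\<lambda>xs. D (map (\<lambda>g. g xs) ?gs @ drop 1 xs))"
    by (rule decidable_prefix) (use D(1) in \<open>auto intro: rec_fn_\<tau>1 rec_fn_\<tau>2 rec_fn_proj\<close>)
  moreover have "(\<exists>t. P (t # xs)) \<longleftrightarrow> (\<exists>s. D (\<tau>1 s # \<tau>2 s # xs))" if "length xs = k" for xs
    using that by (auto simp: D(2)) (metis \<tau>_surj)
  ultimately show ?thesis unfolding ce_pred_def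
    by (intro exI[of _ "\<lambda>xs. D (map (\<lambda>g. g xs) ?gs @ drop 1 xs)"]) simp
qed

lemma ce_pred_conj:
  assumes "ce_pred k P" "ce_pred k Q" shows "ce_pred k (\<lambda>xs. P xs \<and> Q xs)"
proof -
  obtain D where D: "decidable (Suc k) D" "\<And>xs. length xs = k \<Longrightarrow> P xs = (\<exists>t. D (t # xs))"
    using assms(1) unfolding ce_pred_def by blast
  obtain E where E: "decidable (Suc k) E" "\<And>xs. length xs = k \<Longrightarrow> Q xs = (\<exists>t. E (t # xs))"
    using assms(2) unfolding ce_pred_def by blast
  have "decidable (1 + k) (\<lambda>xs. D (map (\<lambda>g. g xs) [\<lambda>xs. \<tau>1 (xs ! 0)] @ drop 1 xs))"
    by (rule decidable_prefix) (use D(1) in \<open>auto intro: rec_fn_\<tau>1 rec_fn_proj\<close>)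
  moreover have "decidable (1 + k) (\<lambda>xs. E (map (\<lambda>g. g xs) [\<lambda>xs. \<tau>2 (xs ! 0)] @ drop 1 xs))"
    by (rule decidable_prefix) (use E(1) in \<open>auto intro: rec_fn_\<tau>2 rec_fn_proj\<close>)
  ultimately have "decidable (Suc k) (\<lambda>xs. D (\<tau>1 (xs ! 0) # drop 1 xs) \<and> E (\<tau>2 (xs ! 0) # drop 1 xs))"
    using decidable_conj by simp
  moreover have "P xs \<and> Q xs \<longleftrightarrow> (\<exists>s. D (\<tau>1 s # xs) \<and> E (\<tau>2 s # xs))" if "length xs = k" for xs
    using that by (auto simp: D(2) E(2)) (metis \<tau>_surj)
  ultimately show ?thesis unfolding ce_pred_def
    by (intro exI[of _ "\<lambda>xs. D (\<tau>1 (xs ! 0) # drop 1 xs) \<and> E (\<tau>2 (xs ! 0) # drop 1 xs)"]) simp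
qed

lemma ce_pred_Ball:
  assumes "finite A" "\<And>a. a \<in> A \<Longrightarrow> ce_pred k (P a)"
  shows "ce_pred k (\<lambda>xs. \<forall>a\<in>A. P a xs)"
  using assms by (induction A) (auto intro: ce_pred_conj ce_pred_decidable decidable_const)

text \<open>One witness for each \<open>i \<le> f xs\<close> is needed; they form a finite nonempty
  sequence with a single code \<open>c\<close>, and for given \<open>c\<close> only a decidable
  bounded check remains.\<close>

lemma ce_pred_all_le:
  assumes "ce_pred (Suc k) P" "rec_fn k f" shows "ce_pred k (\<lambda>xs. \<forall>i\<le>f xs. P (i # xs))"
proof -
  obtain D where D: "decidable (Suc (Suc k)) D" "\<And>xs. length xs = Suc k \<Longrightarrow> P xs = (\<exists>t. D (t # xs))"
    using assms(1) unfolding ce_pred_def by blast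
  \<comment> \<open>The argument list is \<open>[i, c] @ xs\<close>.\<close>
  let ?gs = "[\<lambda>xs. \<sigma> (xs ! 1) (xs ! 0), \<lambda>xs. xs ! 0]"
  have "decidable (2 + k) (\<lambda>xs. D (map (\<lambda>g. g xs) ?gs @ drop 2 xs))"
    by (rule decidable_prefix) (use D(1) in \<open>auto intro: rec_fn_\<sigma> rec_fn_proj\<close>)
  moreover have "rec_fn (Suc k) (\<lambda>xs. f (tl xs))" using assms(2) by (rule rec_fn_tl)
  ultimately have "decidable (Suc k) (\<lambda>xs. \<forall>i\<le>f (tl xs). D (map (\<lambda>g. g (i # xs)) ?gs @ drop 2 (i # xs)))"
    using decidable_all_le[of "Suc k" "\<lambda>xs. D (map (\<lambda>g. g xs) ?gs @ drop 2 xs)" "\<lambda>xs. f (tl xs)"] by simp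
  moreover have "(\<forall>i\<le>f xs. P (i # xs)) \<longleftrightarrow> (\<exists>c. \<forall>i\<le>f xs. D (\<sigma> c i # i # xs))" if "length xs = k" for xs
  proof
    assume "\<forall>i\<le>f xs. P (i # xs)"
    then have "\<forall>i\<le>f xs. \<exists>t. D (t # i # xs)" using that by (simp add: D(2))
    then obtain t where t: "\<And>i. i \<le> f xs \<Longrightarrow> D (t i # i # xs)" by metis
    obtain c where "\<And>i. i < Suc (f xs) \<Longrightarrow> \<sigma> c i = map t [0..<Suc (f xs)] ! i"
      using \<sigma>_surj[of "map t [0..<Suc (f xs)]"] by (auto simp del: upt_Suc)
    then have "\<And>i. i \<le> f xs \<Longrightarrow> \<sigma> c i = t i" by (simp del: upt_Suc)
    then show "\<exists>c. \<forall>i\<le>f xs. D (\<sigma> c i # i # xs)" using t by (intro exI[of _ c]) simp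
  qed (use that D(2) in auto)
  ultimately show ?thesis unfolding ce_pred_def
    by (intro exI[of _ "\<lambda>xs. \<forall>i\<le>f (tl xs). D (map (\<lambda>g. g (i # xs)) ?gs @ drop 2 (i # xs))"])
       (simp add: drop_Suc numeral_2_eq_2)
qed

lemma ce_pred_all_less:
  assumes "ce_pred (Suc k) P" "rec_fn k f" shows "ce_pred k (\<lambda>xs. \<forall>i<f xs. P (i # xs))"
proof -
  \<comment> \<open>The first disjunct makes the index \<open>i = f xs\<close> harmless, which also
    handles \<open>f xs = 0\<close>.\<close>
  have "ce_pred (Suc k) (\<lambda>xs. f (tl xs) \<le> xs ! 0 \<or> P xs)"
    by (intro ce_pred_disj ce_pred_decidable decidable_le rec_fn_tl assms rec_fn_proj) simp
  from ce_pred_all_le[OF this assms(2)] show ?thesis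
    by (rule ce_pred_cong) (fastforce simp: not_le order.order_iff_strict)
qed

text \<open>Bridge from programs to searches, by induction on the program: intermediate values
  become codes under \<open>\<sigma>\<close>. The output is the head of the list.\<close>

lemma ce_pred_evalr: "ce_pred (Suc k) (\<lambda>xs. evalr p (tl xs) (hd xs))"
proof (induction p arbitrary: k)
  case Zero
  have "ce_pred (Suc k) (\<lambda>xs. xs ! 0 = 0)"
    by (intro ce_pred_decidable decidable_eq rec_fn_proj rec_fn_const) simp
  then show ?case by (rule ce_pred_cong) (auto simp: evalr_Zero_iff length_Suc_conv)
next
  case Succ
  show ?case
  proof (cases k)
    case 0
    show ?thesis unfolding 0
      by (rule ce_pred_cong[OF ce_pred_decidable[OF decidable_const[of _ False]]])
         (auto simp: length_Suc_conv evalr_Succ_iff)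
  next
    case (Suc k')
    have "ce_pred (Suc k) (\<lambda>xs. xs ! 0 = Suc (xs ! 1))" unfolding Suc
      by (intro ce_pred_decidable decidable_eq rec_fn_proj rec_fn_Suc) simp_all
    then show ?thesis by (rule ce_pred_cong) (auto simp: evalr_Succ_iff length_Suc_conv Suc)
  qed
next
  case (Proj i)
  show ?case
  proof (cases "i < k")
    case True
    then have "ce_pred (Suc k) (\<lambda>xs. xs ! 0 = xs ! Suc i)"
      by (intro ce_pred_decidable decidable_eq rec_fn_proj) simp_all
    then show ?thesis by (rule ce_pred_cong) (use True in \<open>auto simp: evalr_Proj_iff length_Suc_conv\<close>)
  next
    case False
    show ?thesis
      by (rule ce_pred_cong[OF ce_pred_decidable[OF decidable_const[of _ False]]])
         (use False in \<open>auto simp: evalr_Proj_iff\<close>)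
  qed
next
  case (Comp f gs)
  have 1: "ce_pred (2 + k) (\<lambda>xs. evalr (gs ! i) (drop 2 xs) (\<sigma> (xs ! 0) i))" if "i < length gs" for i
    using ce_pred_evalr_prefix[OF Comp.IH(2)[OF nth_mem[OF that]], of 2 k "\<lambda>xs. \<sigma> (xs ! 0) i" "[]"]
    by (simp add: rec_fn_\<sigma> rec_fn_proj rec_fn_const)
  have 2: "ce_pred (2 + k) (\<lambda>xs. evalr f (map (\<sigma> (xs ! 0)) [0..<length gs]) (xs ! 1))"
  proof -
    let ?hs = "(\<lambda>xs. xs ! 1) # map (\<lambda>i xs. \<sigma> (xs ! 0) i) [0..<length gs]"
    have "ce_pred (2 + k) (\<lambda>xs. evalr f (tl (map (\<lambda>g. g xs) ?hs)) (hd (map (\<lambda>g. g xs) ?hs)))"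
      by (rule ce_pred_subst) (use Comp.IH(1)[of "length gs"] in \<open>auto intro: rec_fn_\<sigma> rec_fn_proj rec_fn_const\<close>)
    then show ?thesis by (simp add: comp_def)
  qed
  have "ce_pred (Suc (Suc k)) (\<lambda>xs. (\<forall>i\<in>{..<length gs}. evalr (gs ! i) (drop 2 xs) (\<sigma> (xs ! 0) i))
      \<and> evalr f (map (\<sigma> (xs ! 0)) [0..<length gs]) (xs ! 1))"
    using 1 2 by (intro ce_pred_conj ce_pred_Ball) auto
  from ce_pred_ex[OF this] show ?case
  proof (rule ce_pred_cong)
    fix xs :: "nat list" assume "length xs = Suc k"
    then obtain y ys where xs: "xs = y # ys" by (cases xs) auto
    have "(\<exists>c. (\<forall>i<length gs. evalr (gs ! i) ys (\<sigma> c i)) \<and> evalr f (map (\<sigma> c) [0..<length gs]) y)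
      \<longleftrightarrow> evalr (Comp f gs) ys y" (is "?L \<longleftrightarrow> ?R")
    proof
      assume ?L
      then obtain c where "\<forall>i<length gs. evalr (gs ! i) ys (\<sigma> c i)" "evalr f (map (\<sigma> c) [0..<length gs]) y"
        by blast
      then show ?R unfolding evalr_Comp_iff by (intro exI[of _ "map (\<sigma> c) [0..<length gs]"]) simp
    next
      assume ?R
      then obtain zs where zs: "length zs = length gs" "\<forall>i<length gs. evalr (gs ! i) ys (zs ! i)" "evalr f zs y"
        unfolding evalr_Comp_iff by blast
      \<comment> \<open>Only nonempty sequences have codes and \<open>gs\<close> may be empty, hence
        the padding by \<open>0\<close>.\<close>
      obtain c where "\<And>i. i < length (zs @ [0]) \<Longrightarrow> \<sigma> c i = (zs @ [0]) ! i"
        using \<sigma>_surj[of "zs @ [0]"] by blast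
      then have c: "\<And>i. i < length gs \<Longrightarrow> \<sigma> c i = zs ! i" by (simp add: zs(1) nth_append)
      then have "map (\<sigma> c) [0..<length gs] = zs" using zs(1) by (auto intro: nth_equalityI)
      then show ?L using zs c by (intro exI[of _ c]) simp
    qed
    then show "(\<exists>t. (\<forall>i\<in>{..<length gs}. evalr (gs ! i) (drop 2 (t # xs)) (\<sigma> ((t # xs) ! 0) i))
      \<and> evalr f (map (\<sigma> ((t # xs) ! 0)) [0..<length gs]) ((t # xs) ! 1)) = evalr (Comp f gs) (tl xs) (hd xs)"
      by (simp add: xs lessThan_def)
  qed
next
  case (Prec f g)
  show ?case
  proof (cases k)
    case 0
    show ?thesis unfolding 0
      by (rule ce_pred_cong[OF ce_pred_decidable[OF decidable_const[of _ False]]])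
         (auto simp: length_Suc_conv evalr_Prec_Nil)
  next
    case (Suc k')
    \<comment> \<open>the argument lists below are \<open>[c, y, n] @ xs\<close> and \<open>[i, c, y, n] @ xs\<close>\<close>
    have 1: "ce_pred (3 + k') (\<lambda>xs. evalr f (drop 3 xs) (\<sigma> (xs ! 0) 0))"
      using ce_pred_evalr_prefix[OF Prec.IH(1), of 3 k' "\<lambda>xs. \<sigma> (xs ! 0) 0" "[]"]
      by (simp add: rec_fn_\<sigma> rec_fn_proj rec_fn_const)
    have "ce_pred (4 + k') (\<lambda>xs. evalr g (xs ! 0 # \<sigma> (xs ! 1) (xs ! 0) # drop 4 xs) (\<sigma> (xs ! 1) (Suc (xs ! 0))))"
    proof -
      let ?hs = "[\<lambda>xs. xs ! 0, \<lambda>xs. \<sigma> (xs ! 1) (xs ! 0)]"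
      have "ce_pred (4 + k') (\<lambda>xs. evalr g (map (\<lambda>g. g xs) ?hs @ drop 4 xs) (\<sigma> (xs ! 1) (Suc (xs ! 0))))"
        by (rule ce_pred_evalr_prefix[OF Prec.IH(2)]) (auto simp: rec_fn_\<sigma> rec_fn_proj rec_fn_Suc)
      then show ?thesis by simp
    qed
    then have "ce_pred (3 + k') (\<lambda>xs. \<forall>i<xs ! 2. evalr g ((i # xs) ! 0 # \<sigma> ((i # xs) ! 1) ((i # xs) ! 0) # drop 4 (i # xs))
       (\<sigma> ((i # xs) ! 1) (Suc ((i # xs) ! 0))))"
      by (intro ce_pred_all_less[where P = "\<lambda>xs. evalr g (xs ! 0 # \<sigma> (xs ! 1) (xs ! 0) # drop 4 xs) (\<sigma> (xs ! 1) (Suc (xs ! 0)))"] rec_fn_proj)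
         (simp_all add: eval_nat_numeral)
    then have 2: "ce_pred (3 + k') (\<lambda>xs. \<forall>i<xs ! 2. evalr g (i # \<sigma> (xs ! 0) i # drop 3 xs) (\<sigma> (xs ! 0) (Suc i)))"
      by (simp add: eval_nat_numeral)
    have 3: "ce_pred (3 + k') (\<lambda>xs. \<sigma> (xs ! 0) (xs ! 2) = xs ! 1)"
      by (intro ce_pred_decidable decidable_eq rec_fn_\<sigma> rec_fn_proj) simp_all
    have "ce_pred (Suc (Suc k)) (\<lambda>xs. evalr f (drop 3 xs) (\<sigma> (xs ! 0) 0) \<and>
       (\<forall>i<xs ! 2. evalr g (i # \<sigma> (xs ! 0) i # drop 3 xs) (\<sigma> (xs ! 0) (Suc i))) \<and> \<sigma> (xs ! 0) (xs ! 2) = xs ! 1)"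
      using ce_pred_conj[OF 1 ce_pred_conj[OF 2 3]] by (simp add: Suc numeral_3_eq_3)
    from ce_pred_ex[OF this] show ?thesis
    proof (rule ce_pred_cong)
      fix xs :: "nat list" assume "length xs = Suc k"
      then obtain y n ys where xs: "xs = y # n # ys" by (auto simp: Suc length_Suc_conv)
      have "(\<exists>c. evalr f ys (\<sigma> c 0) \<and> (\<forall>i<n. evalr g (i # \<sigma> c i # ys) (\<sigma> c (Suc i))) \<and> \<sigma> c n = y)
        \<longleftrightarrow> evalr (Prec f g) (n # ys) y" (is "?L \<longleftrightarrow> ?R")
      proof
        assume ?L
        then obtain c where "evalr f ys (\<sigma> c 0)" "\<forall>i<n. evalr g (i # \<sigma> c i # ys) (\<sigma> c (Suc i))" "\<sigma> c n = y"
          by blast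
        then show ?R unfolding evalr_Prec_iff
          by (intro exI[of _ "map (\<sigma> c) [0..<Suc n]"]) (simp del: upt_Suc)
      next
        assume ?R
        then obtain zs where zs: "length zs = Suc n" "evalr f ys (zs ! 0)"
            "\<forall>i<n. evalr g (i # zs ! i # ys) (zs ! Suc i)" "zs ! n = y"
          unfolding evalr_Prec_iff by blast
        then have "zs \<noteq> []" by auto
        then obtain c where "\<And>i. i < length zs \<Longrightarrow> \<sigma> c i = zs ! i"
          using \<sigma>_surj by blast
        then show ?L using zs by (intro exI[of _ c]) simp
      qed
      then show "(\<exists>t. evalr f (drop 3 (t # xs)) (\<sigma> ((t # xs) ! 0) 0) \<and>
          (\<forall>i<(t # xs) ! 2. evalr g (i # \<sigma> ((t # xs) ! 0) i # drop 3 (t # xs)) (\<sigma> ((t # xs) ! 0) (Suc i))) \<and>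
          \<sigma> ((t # xs) ! 0) ((t # xs) ! 2) = (t # xs) ! 1) = evalr (Prec f g) (tl xs) (hd xs)"
        by (simp add: xs eval_nat_numeral)
    qed
  qed
next
  case (Mn f)
  have 1: "ce_pred (1 + k) (\<lambda>xs. evalr f (xs ! 0 # drop 1 xs) 0)"
    using ce_pred_evalr_prefix[OF Mn.IH, of 1 k "\<lambda>xs. 0" "[\<lambda>xs. xs ! 0]"]
    by (simp add: rec_fn_proj rec_fn_const)
  \<comment> \<open>the argument list is \<open>[z, m, y] @ xs\<close>\<close>
  have "ce_pred (3 + k) (\<lambda>xs. evalr f (xs ! 1 # drop 3 xs) (xs ! 0))"
    using ce_pred_evalr_prefix[OF Mn.IH, of 3 k "\<lambda>xs. xs ! 0" "[\<lambda>xs. xs ! 1]"]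
    by (simp add: rec_fn_proj rec_fn_const)
  moreover have "ce_pred (3 + k) (\<lambda>xs. xs ! 0 \<noteq> 0)"
    by (intro ce_pred_decidable decidable_not decidable_eq rec_fn_proj rec_fn_const) simp
  ultimately have "ce_pred (3 + k) (\<lambda>xs. evalr f (xs ! 1 # drop 3 xs) (xs ! 0) \<and> xs ! 0 \<noteq> 0)"
    by (rule ce_pred_conj)
  then have "ce_pred (Suc (Suc (Suc k))) (\<lambda>xs. evalr f (xs ! 1 # drop 3 xs) (xs ! 0) \<and> xs ! 0 \<noteq> 0)"
    by (simp add: eval_nat_numeral)
  from ce_pred_all_less[OF ce_pred_ex[OF this] rec_fn_proj[of 0 "Suc k"]]
  have 2: "ce_pred (Suc k) (\<lambda>xs. \<forall>m<xs ! 0. \<exists>z. evalr f (m # drop 1 xs) z \<and> z \<noteq> 0)"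
    by (simp add: eval_nat_numeral)
  from 1 have "ce_pred (Suc k) (\<lambda>xs. evalr f (xs ! 0 # drop 1 xs) 0)" by simp
  from ce_pred_conj[OF this 2] show ?case
    by (rule ce_pred_cong) (auto simp: evalr_Mn_iff length_Suc_conv)
qed

lemma ce_pred_ce_set:
  assumes "ce_set A" shows "ce_pred 1 (\<lambda>xs. xs ! 0 \<in> A)"
proof -
  obtain p where p: "A = {x. \<exists>y. evalr p [x] y}" using assms unfolding ce_set_def by blast
  from ce_pred_ex[OF ce_pred_evalr[of 1 p]] have "ce_pred 1 (\<lambda>xs. \<exists>y. evalr p xs y)" by simp
  then show ?thesis
  proof (rule ce_pred_cong)
    fix xs :: "nat list" assume "length xs = 1"
    then obtain x where "xs = [x]" by (cases xs) auto
    then show "(\<exists>y. evalr p xs y) = (xs ! 0 \<in> A)" unfolding p by simp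
  qed
qed

text \<open>Minimising \<open>j\<close> directly would require deciding \<open>P\<close>. Instead
  the least code of a pair of a witness \<open>t\<close> and a value \<open>j\<close> is sought, and
  \<open>j\<close> is extracted from it.\<close>

lemma ce_pred_uniformization:
  assumes P: "ce_pred 2 P" and ex: "\<And>k. \<exists>j. P [k, j]"
  shows "\<exists>f. computable1 f \<and> (\<forall>k. P [k, f k])"
proof -
  obtain D where D: "decidable (Suc 2) D" "\<And>xs. length xs = 2 \<Longrightarrow> P xs = (\<exists>t. D (t # xs))"
    using P unfolding ce_pred_def by blast
  have D2: "P [k, j] \<longleftrightarrow> (\<exists>t. D [t, k, j])" for k j
    using D(2)[of "[k, j]"] by simp
  \<comment> \<open>This turns \<open>[s, k]\<close>, where \<open>s\<close> codes the pair of
    \<open>t\<close> and \<open>j\<close>, into \<open>[t, k, j]\<close>.\<close>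
  let ?gs = "[\<lambda>xs. \<tau>1 (xs ! 0), \<lambda>xs. xs ! 1, \<lambda>xs. \<tau>2 (xs ! 0)]"
  let ?E = "\<lambda>xs. D (map (\<lambda>g. g xs) ?gs @ drop 2 xs)"
  have E: "decidable (Suc 1) ?E"
  proof -
    have "decidable (2 + 0) ?E"
      by (rule decidable_prefix) (use D(1) in \<open>auto intro: rec_fn_\<tau>1 rec_fn_\<tau>2 rec_fn_proj simp: numeral_2_eq_2 numeral_3_eq_3\<close>)
    then show ?thesis by (simp add: numeral_2_eq_2)
  qed
  have E_ex: "\<exists>t. ?E (t # xs)" if xs: "length xs = 1" for xs
  proof -
    obtain k where k: "xs = [k]" using xs by (auto simp: length_Suc_conv)
    obtain j t where "D [t, k, j]" using ex[of k] unfolding D2 by blast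
    moreover obtain s where "\<tau>1 s = t" "\<tau>2 s = j" by (rule \<tau>_surj)
    ultimately show ?thesis by (intro exI[of _ s]) (simp add: k)
  qed
  define f where "f k = \<tau>2 (LEAST t. ?E [t, k])" for k
  have "rec_fn 1 (\<lambda>xs. \<tau>2 (LEAST t. ?E (t # xs)))"
    by (intro rec_fn_\<tau>2 rec_fn_Least E E_ex)
  then have "computable1 f" unfolding computable1_def
    by (rule rec_fn_cong) (auto simp: f_def length_Suc_conv)
  moreover have "P [k, f k]" for k
    using LeastI_ex[OF E_ex[of "[k]"]] by (auto simp: f_def D2)
  ultimately show ?thesis by blast
qed

end

section \<open>Recursive rational functions and strict comparison of distances\<close>

lemma rec_rat_fnI:
  assumes "rec_fn k a" "rec_fn k b" "rec_fn k c"
    "\<And>xs. length xs = k \<Longrightarrow> G xs = (of_nat (a xs) - of_nat (b xs)) / of_nat (c xs + 1)"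
  shows "rec_rat_fn k G"
  using assms unfolding rec_rat_fn_def by blast

lemma rec_rat_fn_subst:
  assumes "rec_rat_fn (length gs) G" "\<And>g. g \<in> set gs \<Longrightarrow> rec_fn k g"
  shows "rec_rat_fn k (\<lambda>xs. G (map (\<lambda>g. g xs) gs))"
proof -
  obtain a b c where *: "rec_fn (length gs) a" "rec_fn (length gs) b" "rec_fn (length gs) c"
    "\<And>xs. length xs = length gs \<Longrightarrow> G xs = (of_nat (a xs) - of_nat (b xs)) / of_nat (c xs + 1)"
    using assms(1) unfolding rec_rat_fn_def by blast
  show ?thesis
    by (rule rec_rat_fnI[OF rec_fn_comp[OF *(1) assms(2)] rec_fn_comp[OF *(2) assms(2)] rec_fn_comp[OF *(3) assms(2)]])
       (simp_all add: *(4))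
qed

lemma rec_rat_fn_tl: "rec_rat_fn k G \<Longrightarrow> rec_rat_fn (Suc k) (\<lambda>xs. G (tl xs))"
  unfolding rec_rat_fn_def
proof (elim exE conjE)
  fix a b c assume "rec_fn k a" "rec_fn k b" "rec_fn k c"
    and *: "\<forall>xs. length xs = k \<longrightarrow> G xs = (of_nat (a xs) - of_nat (b xs)) / of_nat (c xs + 1)"
  then show "\<exists>a b c. rec_fn (Suc k) a \<and> rec_fn (Suc k) b \<and> rec_fn (Suc k) c \<and>
    (\<forall>xs. length xs = Suc k \<longrightarrow> G (tl xs) = (of_nat (a xs) - of_nat (b xs)) / of_nat (c xs + 1))"
    by (intro exI[of _ "\<lambda>xs. a (tl xs)"] exI[of _ "\<lambda>xs. b (tl xs)"] exI[of _ "\<lambda>xs. c (tl xs)"])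
       (simp add: rec_fn_tl)
qed

lemma rec_rat_fn_add:
  assumes "rec_rat_fn k F" "rec_rat_fn k G" shows "rec_rat_fn k (\<lambda>xs. F xs + G xs)"
proof -
  obtain a b c where F: "rec_fn k a" "rec_fn k b" "rec_fn k c"
    "\<And>xs. length xs = k \<Longrightarrow> F xs = (of_nat (a xs) - of_nat (b xs)) / of_nat (c xs + 1)"
    using assms(1) unfolding rec_rat_fn_def by blast
  obtain a' b' c' where G: "rec_fn k a'" "rec_fn k b'" "rec_fn k c'"
    "\<And>xs. length xs = k \<Longrightarrow> G xs = (of_nat (a' xs) - of_nat (b' xs)) / of_nat (c' xs + 1)"
    using assms(2) unfolding rec_rat_fn_def by blast
  \<comment> \<open>Denominators are stored minus one:
    \<open>(c + 1) * (c' + 1) - 1 = c * c' + c + c'\<close>.\<close>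
  have *: "(of_nat a - of_nat b) / of_nat (c + 1) + (of_nat a' - of_nat b') / of_nat (c' + 1) =
      (of_nat (a * Suc c' + a' * Suc c) - of_nat (b * Suc c' + b' * Suc c)) / (of_nat (c * c' + c + c' + 1) :: rat)"
    for a b c a' b' c' :: nat
  proof -
    define u v where "u = (1 + of_nat c :: rat)" and "v = (1 + of_nat c' :: rat)"
    have uv: "u \<noteq> 0" "v \<noteq> 0" unfolding u_def v_def by (simp_all add: add_nonneg_eq_0_iff)
    have "of_nat (c * c' + c + c' + 1) = u * v" by (simp add: u_def v_def algebra_simps)
    moreover have "of_nat (Suc c) = u" "of_nat (Suc c') = v" "of_nat (c + 1) = u" "of_nat (c' + 1) = v"
      by (simp_all add: u_def v_def)
    ultimately show ?thesis
      unfolding of_nat_add[of "a * Suc c'"] of_nat_add[of "b * Suc c'"] of_nat_mult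
      using uv by (simp only:) (simp add: field_simps)
  qed
  show ?thesis
    by (rule rec_rat_fnI[of k "\<lambda>xs. a xs * Suc (c' xs) + a' xs * Suc (c xs)"
          "\<lambda>xs. b xs * Suc (c' xs) + b' xs * Suc (c xs)" "\<lambda>xs. c xs * c' xs + c xs + c' xs"])
       (simp_all only: F G rec_fn_add rec_fn_mult rec_fn_Suc *)
qed

lemma rec_rat_fn_uminus: "rec_rat_fn k F \<Longrightarrow> rec_rat_fn k (\<lambda>xs. - F xs)"
  unfolding rec_rat_fn_def
proof (elim exE conjE)
  fix a b c assume "rec_fn k a" "rec_fn k b" "rec_fn k c"
    and *: "\<forall>xs. length xs = k \<longrightarrow> F xs = (of_nat (a xs) - of_nat (b xs)) / of_nat (c xs + 1)"
  moreover have "\<forall>xs. length xs = k \<longrightarrow> - F xs = (of_nat (b xs) - of_nat (a xs)) / of_nat (c xs + 1)"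
    using * by (simp add: minus_divide_left)
  ultimately show "\<exists>a b c. rec_fn k a \<and> rec_fn k b \<and> rec_fn k c \<and>
    (\<forall>xs. length xs = k \<longrightarrow> - F xs = (of_nat (a xs) - of_nat (b xs)) / of_nat (c xs + 1))"
    by blast
qed

lemma rec_rat_fn_diff: "rec_rat_fn k F \<Longrightarrow> rec_rat_fn k G \<Longrightarrow> rec_rat_fn k (\<lambda>xs. F xs - G xs)"
  using rec_rat_fn_add[OF _ rec_rat_fn_uminus, of k F G] by simp

lemma rec_rat_fn_half_power:
  assumes "rec_fn k f" shows "rec_rat_fn k (\<lambda>xs. (1/2) ^ f xs)"
proof (rule rec_rat_fnI[OF rec_fn_const[of k 1] rec_fn_const[of k 0]])
  show "rec_fn k (\<lambda>xs. 2 ^ f xs - 1)" by (intro rec_fn_diff rec_fn_power rec_fn_const assms)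
  show "(1/2) ^ f xs = (of_nat 1 - of_nat 0) / (of_nat (2 ^ f xs - 1 + 1) :: rat)" for xs
    by (simp add: power_one_over)
qed

lemma decidable_rat_pos:
  assumes "rec_rat_fn k F" shows "decidable k (\<lambda>xs. 0 < F xs)"
proof -
  obtain a b c where F: "rec_fn k a" "rec_fn k b" "rec_fn k c"
    "\<And>xs. length xs = k \<Longrightarrow> F xs = (of_nat (a xs) - of_nat (b xs)) / of_nat (c xs + 1)"
    using assms(1) unfolding rec_rat_fn_def by blast
  have "decidable k (\<lambda>xs. b xs < a xs)" by (intro decidable_less F)
  then show ?thesis
  proof (rule decidable_cong)
    fix xs :: "nat list" assume xs: "length xs = k"
    have "(0::rat) < of_nat (c xs + 1)" by simp
    then show "(b xs < a xs) = (0 < F xs)"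
      unfolding F(4)[OF xs] zero_less_divide_iff by (auto simp del: of_nat_add)
  qed
qed

lemma half_power_real_of_rat: "real_of_rat ((1/2) ^ i) = (1/2) ^ i"
  by (simp add: of_rat_power of_rat_divide)

text \<open>The upper bounds \<open>G i + (1/2) ^ i\<close> exceed \<open>d\<close> by less than
  twice \<open>(1/2) ^ i\<close>. So as soon as \<open>(1/2) ^ i\<close> is below half the gap to
  \<open>r\<close>, the bound is below \<open>r\<close>.\<close>

lemma real_less_iff_approx:
  assumes "\<And>i. \<bar>d - real_of_rat (G i)\<bar> < (1/2) ^ i"
  shows "d < real_of_rat r \<longleftrightarrow> (\<exists>i. 0 < r - (G i + (1/2) ^ i))"
proof
  assume "d < real_of_rat r"
  then obtain i where i: "(1/2) ^ i < (real_of_rat r - d) / 2"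
    using real_arch_pow_inv[of "(real_of_rat r - d) / 2" "1/2"] by auto
  define h where "h = (1/2 :: real) ^ i"
  have "\<bar>d - real_of_rat (G i)\<bar> < h" "h < (real_of_rat r - d) / 2"
    using i assms[of i] by (simp_all only: h_def)
  then have "real_of_rat (G i) + h < real_of_rat r" by argo
  then have "real_of_rat (G i + (1/2) ^ i) < real_of_rat r"
    by (simp only: of_rat_add half_power_real_of_rat h_def)
  then show "\<exists>i. 0 < r - (G i + (1/2) ^ i)" unfolding of_rat_less diff_gt_0_iff_gt by (rule exI)
next
  assume "\<exists>i. 0 < r - (G i + (1/2) ^ i)"
  then obtain i where "real_of_rat (G i + (1/2) ^ i) < real_of_rat r"
    unfolding of_rat_less diff_gt_0_iff_gt by (rule exE)
  then show "d < real_of_rat r" using assms[of i] unfolding of_rat_add half_power_real_of_rat by linarith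
qed

locale computable_metric = enumerations q \<tau>1 \<tau>2 \<sigma> \<eta>
  for q :: "nat \<Rightarrow> rat" and \<tau>1 \<tau>2 :: "nat \<Rightarrow> nat" and \<sigma> :: "nat \<Rightarrow> nat \<Rightarrow> nat" and \<eta> :: "nat \<Rightarrow> nat" +
  fixes \<alpha> :: "nat \<Rightarrow> 'a::metric_space"
  assumes cms: "computable_metric_space \<alpha>"
begin

lemma ce_pred_dist_less:
  assumes f: "rec_fn k f" and g: "rec_fn k g" and r: "rec_rat_fn k r"
  shows "ce_pred k (\<lambda>xs. dist (\<alpha> (f xs)) (\<alpha> (g xs)) < real_of_rat (r xs))" (is ?less)
    and "ce_pred k (\<lambda>xs. real_of_rat (r xs) < dist (\<alpha> (f xs)) (\<alpha> (g xs)))" (is ?greater)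
proof -
  have "rec_real_fn 2 (\<lambda>xs. dist (\<alpha> (xs ! 0)) (\<alpha> (xs ! 1)))"
    using cms unfolding computable_metric_space_def by blast
  then obtain G where G: "rec_rat_fn (Suc 2) G"
    and approx: "\<forall>xs i. length xs = 2 \<longrightarrow> \<bar>dist (\<alpha> (xs ! 0)) (\<alpha> (xs ! 1)) - real_of_rat (G (xs @ [i]))\<bar> < (1/2) ^ i"
    unfolding rec_real_fn_def by blast
  have approx: "\<bar>dist (\<alpha> a) (\<alpha> b) - real_of_rat (G [a, b, i])\<bar> < (1/2) ^ i" for a b i
    using approx[rule_format, of "[a, b]" i] by simp
  let ?gs = "[\<lambda>xs. f (tl xs), \<lambda>xs. g (tl xs), \<lambda>xs. xs ! 0]"
  have Gk: "rec_rat_fn (Suc k) (\<lambda>xs. G (map (\<lambda>g. g xs) ?gs))"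
    by (rule rec_rat_fn_subst) (use G f g in \<open>auto simp: rec_fn_tl rec_fn_proj eval_nat_numeral\<close>)
  have hp: "rec_rat_fn (Suc k) (\<lambda>xs. (1/2) ^ (xs ! 0))"
    by (intro rec_rat_fn_half_power rec_fn_proj) simp
  have "ce_pred (Suc k) (\<lambda>xs. 0 < r (tl xs) - (G (map (\<lambda>g. g xs) ?gs) + (1/2) ^ (xs ! 0)))"
    by (intro ce_pred_decidable decidable_rat_pos rec_rat_fn_diff rec_rat_fn_add Gk hp rec_rat_fn_tl r)
  from ce_pred_ex[OF this] show ?less
    by (simp add: real_less_iff_approx[OF approx])
  \<comment> \<open>For the reverse inequality the same criterion is applied to the negated distance
    and the negated rational.\<close>
  have "ce_pred (Suc k) (\<lambda>xs. 0 < - r (tl xs) - (- G (map (\<lambda>g. g xs) ?gs) + (1/2) ^ (xs ! 0)))"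
    by (intro ce_pred_decidable decidable_rat_pos rec_rat_fn_diff rec_rat_fn_add rec_rat_fn_uminus Gk hp rec_rat_fn_tl r)
  moreover have "real_of_rat s < dist (\<alpha> a) (\<alpha> b) \<longleftrightarrow> (\<exists>i. 0 < - s - (- G [a, b, i] + (1/2) ^ i))" for s a b
  proof -
    have "\<bar>- dist (\<alpha> a) (\<alpha> b) - real_of_rat (- G [a, b, i])\<bar> < (1/2) ^ i" for i
      using approx[of a b i] by (simp add: of_rat_minus)
    then have "- dist (\<alpha> a) (\<alpha> b) < real_of_rat (- s) \<longleftrightarrow> (\<exists>i. 0 < - s - (- G [a, b, i] + (1/2) ^ i))"
      by (rule real_less_iff_approx)
    then show ?thesis by (simp only: of_rat_minus neg_less_iff_less)
  qed
  ultimately show ?greater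
    using ce_pred_ex[of k "\<lambda>xs. 0 < - r (tl xs) - (- G (map (\<lambda>g. g xs) ?gs) + (1/2) ^ (xs ! 0))"] by simp
qed

abbreviation ball_center :: "nat \<Rightarrow> 'a" where "ball_center b \<equiv> \<alpha> (\<tau>1 b)"
abbreviation ball_radius :: "nat \<Rightarrow> real" where "ball_radius b \<equiv> real_of_rat (q (\<tau>2 b))"

lemma rec_rat_fn_radius: "rec_fn k f \<Longrightarrow> rec_rat_fn k (\<lambda>xs. q (\<tau>2 (f xs)))"
  using rec_rat_fn_subst[of "[\<lambda>xs. \<tau>2 (f xs)]" "\<lambda>xs. q (xs ! 0)" k] good rec_fn_\<tau>2[of k f]
  unfolding good_enumerations_def by simp

lemma ce_pred_balls_apart:
  assumes "rec_fn k f" "rec_fn k g"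
  shows "ce_pred k (\<lambda>xs. ball_radius (f xs) + ball_radius (g xs) < dist (ball_center (f xs)) (ball_center (g xs)))"
  using ce_pred_dist_less(2)[OF rec_fn_\<tau>1[OF assms(1)] rec_fn_\<tau>1[OF assms(2)]
      rec_rat_fn_add[OF rec_rat_fn_radius[OF assms(1)] rec_rat_fn_radius[OF assms(2)]]]
  by (simp add: of_rat_add)

lemma ce_pred_ball_inside:
  assumes "rec_fn k f" "rec_fn k g" "rec_fn k h"
  shows "ce_pred k (\<lambda>xs. dist (ball_center (f xs)) (\<alpha> (g xs)) + ball_radius (f xs) < (1/2) ^ h xs)"
  using ce_pred_dist_less(1)[OF rec_fn_\<tau>1[OF assms(1)] assms(2)
      rec_rat_fn_diff[OF rec_rat_fn_half_power[OF assms(3)] rec_rat_fn_radius[OF assms(1)]]]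
  by (simp add: of_rat_diff half_power_real_of_rat less_diff_eq)

text \<open>Instance of the comparison of distances in which both points coincide, so that the
  distance is \<open>0\<close>.\<close>

lemma ce_pred_radius_less:
  assumes "rec_fn k f" "rec_fn k h"
  shows "ce_pred k (\<lambda>xs. ball_radius (f xs) < (1/2) ^ h xs)"
  using ce_pred_dist_less(1)[OF assms(1,1)
      rec_rat_fn_diff[OF rec_rat_fn_half_power[OF assms(2)] rec_rat_fn_radius[OF assms(1)]]]
  by (simp add: of_rat_diff half_power_real_of_rat)

end


section \<open>Cubes in sequence space and the Poincare-Miranda property\<close>

lemma tendsto_componentwise:
  fixes f :: "'b \<Rightarrow> 'i \<Rightarrow> 'c::topological_space"
  assumes "\<And>i. ((\<lambda>p. f p i) \<longlongrightarrow> l i) F"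
  shows "(f \<longlongrightarrow> l) F"
proof -
  have "limitin (product_topology (\<lambda>i. euclidean) UNIV) f l F"
    unfolding limitin_componentwise using assms by simp
  then show ?thesis by (simp add: euclidean_product_topology)
qed

lemma tendsto_component:
  fixes f :: "'b \<Rightarrow> 'i \<Rightarrow> 'c::topological_space"
  assumes "(f \<longlongrightarrow> l) F"
  shows "((\<lambda>p. f p i) \<longlongrightarrow> l i) F"
  by (rule continuous_on_tendsto_compose[OF continuous_on_product_coordinates assms]) auto

text \<open>Points are sequences vanishing from index \<open>n\<close> on, as in
  \<open>Euclidean_space n\<close>; the dimension stays an ordinary number, and for
  \<open>n = 0\<close> the cube is a single point.\<close>

definition cube :: "nat \<Rightarrow> real \<Rightarrow> (nat \<Rightarrow> real) set" where
  "cube n r = {x. (\<forall>i<n. \<bar>x i\<bar> \<le> r) \<and> (\<forall>i\<ge>n. x i = 0)}"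

definition open_cube :: "nat \<Rightarrow> real \<Rightarrow> (nat \<Rightarrow> real) set" where
  "open_cube n r = {x. (\<forall>i<n. \<bar>x i\<bar> < r) \<and> (\<forall>i\<ge>n. x i = 0)}"

text \<open>Tychonoff's theorem, with the factor \<open>{0}\<close> in the coordinates from
  \<open>n\<close> on.\<close>

lemma compact_cube: "compact (cube n r)"
proof -
  have eq: "cube n r = PiE UNIV (\<lambda>i. if i < n then {-r..r} else {0})"
  proof (rule set_eqI)
    fix x :: "nat \<Rightarrow> real"
    have "x \<in> PiE UNIV (\<lambda>i. if i < n then {-r..r} else {0}) \<longleftrightarrow> (\<forall>i. x i \<in> (if i < n then {-r..r} else {0}))"
      by (simp add: PiE_UNIV_domain Pi_def)
    also have "\<dots> \<longleftrightarrow> x \<in> cube n r"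
      unfolding cube_def mem_Collect_eq
    proof (intro iffI conjI allI impI; (elim conjE)?)
      fix i assume "\<forall>i. x i \<in> (if i < n then {-r..r} else {0})"
      from spec[OF this, of i] show "i < n \<Longrightarrow> \<bar>x i\<bar> \<le> r" "n \<le> i \<Longrightarrow> x i = 0"
        by (auto simp: abs_le_iff)
    next
      fix i assume "\<forall>i<n. \<bar>x i\<bar> \<le> r" "\<forall>i\<ge>n. x i = 0"
      then show "x i \<in> (if i < n then {-r..r} else {0})"
        using abs_le_D1[of "x i" r] abs_le_D2[of "x i" r] by (cases "i < n") auto
    qed
    finally show "x \<in> cube n r \<longleftrightarrow> x \<in> PiE UNIV (\<lambda>i. if i < n then {-r..r} else {0})" by simp
  qed
  have "compactin (product_topology (\<lambda>i. euclidean) UNIV) (cube n r)"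
    unfolding eq compactin_PiE by auto
  then show ?thesis by (simp add: euclidean_product_topology)
qed

lemma closed_component_le: "closed {x :: nat \<Rightarrow> real. x m \<le> c}"
  and closed_component_ge: "closed {x :: nat \<Rightarrow> real. c \<le> x m}"
  by (intro closed_Collect_le continuous_on_product_coordinates continuous_on_const)+

lemma cube_subset: "r \<le> s \<Longrightarrow> cube n r \<subseteq> cube n s" "open_cube n r \<subseteq> cube n r"
  "r < s \<Longrightarrow> cube n r \<subseteq> open_cube n s"
  by (auto simp: cube_def open_cube_def intro: less_imp_le order_trans le_less_trans)

text \<open>A form of the Poincare--Miranda theorem, obtained from Kuhn's combinatorial lemma on finer and
  finer grids.\<close>

lemma cube_not_covered:
  assumes U: "\<And>m. m < n \<Longrightarrow> openin (top_of_set (cube n 1)) (U m)"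
    and V: "\<And>m. m < n \<Longrightarrow> openin (top_of_set (cube n 1)) (V m)"
    and disj: "\<And>m. m < n \<Longrightarrow> U m \<inter> V m = {}"
    and face: "\<And>m x. m < n \<Longrightarrow> x \<in> cube n 1 \<Longrightarrow> x m = -1 \<Longrightarrow> x \<in> U m"
      "\<And>m x. m < n \<Longrightarrow> x \<in> cube n 1 \<Longrightarrow> x m = 1 \<Longrightarrow> x \<in> V m"
  shows "\<exists>z\<in>cube n 1. \<forall>m<n. z \<notin> U m \<and> z \<notin> V m"
proof -
  \<comment> \<open>Grid on the unit cube with \<open>Suc p\<close> steps of length
    \<open>2 / Suc p\<close> along each axis.\<close>
  define pt :: "nat \<Rightarrow> (nat \<Rightarrow> nat) \<Rightarrow> nat \<Rightarrow> real" where
    "pt p x = (\<lambda>i. if i < n then 2 * real (x i) / real (Suc p) - 1 else 0)" for p x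
  have pt_cube: "pt p x \<in> cube n 1" if "\<forall>i<n. x i \<le> Suc p" for p x
  proof -
    have "\<bar>2 * real (x i) / real (Suc p) - 1\<bar> \<le> 1" if "i < n" for i
    proof -
      have "real (x i) \<le> real (Suc p)" using that \<open>\<forall>i<n. x i \<le> Suc p\<close> by (simp del: of_nat_Suc)
      then have "real (x i) / real (Suc p) \<le> 1" by (simp del: of_nat_Suc)
      moreover have "0 \<le> real (x i) / real (Suc p)" by simp
      ultimately show ?thesis unfolding abs_le_iff times_divide_eq_right[symmetric] by linarith
    qed
    then show ?thesis by (simp add: cube_def pt_def)
  qed
  \<comment> \<open>Label \<open>0\<close> means not in \<open>V i\<close>, which by disjointness
    includes all of \<open>U i\<close>. Kuhn's lemma gives a cell in which, for every axis, both
    labels occur: at the vertices \<open>r i\<close> (in \<open>V i\<close>) and \<open>s i\<close>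
    (not in \<open>V i\<close>).\<close>
  define label where "label p x i = (if pt p x \<in> V i then 1 else (0::nat))" for p x i
  define cell where "cell p r s c \<longleftrightarrow> (\<forall>i<n. c i < Suc p) \<and> (\<forall>i<n.
      (\<forall>j<n. c j \<le> r i j \<and> r i j \<le> c j + 1) \<and> (\<forall>j<n. c j \<le> s i j \<and> s i j \<le> c j + 1) \<and>
      pt p (r i) \<in> V i \<and> pt p (s i) \<notin> V i)" for p r s c
  have "\<exists>r s c. cell p r s c" for p
  proof -
    obtain c where c: "\<forall>i<n. c i < Suc p"
      and rs: "\<forall>i<n. \<exists>r s. (\<forall>j<n. c j \<le> r j \<and> r j \<le> c j + 1) \<and> (\<forall>j<n. c j \<le> s j \<and> s j \<le> c j + 1) \<and>
        label p r i \<noteq> label p s i"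
    proof (rule kuhn_lemma[of "Suc p" n "label p"])
      show "\<forall>x. (\<forall>i<n. x i \<le> Suc p) \<longrightarrow> (\<forall>i<n. x i = 0 \<longrightarrow> label p x i = 0)"
      proof (intro allI impI)
        fix x i assume x: "\<forall>i<n. x i \<le> Suc p" and i: "i < n" "x i = 0"
        then have "pt p x \<in> U i" using pt_cube by (intro face) (auto simp: pt_def)
        then show "label p x i = 0" using disj[OF i(1)] by (auto simp: label_def)
      qed
      show "\<forall>x. (\<forall>i<n. x i \<le> Suc p) \<longrightarrow> (\<forall>i<n. x i = Suc p \<longrightarrow> label p x i = 1)"
      proof (intro allI impI)
        fix x i assume x: "\<forall>i<n. x i \<le> Suc p" and i: "i < n" "x i = Suc p"
        then have "pt p x \<in> V i" using pt_cube by (intro face) (auto simp: pt_def simp del: of_nat_Suc)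
        then show "label p x i = 1" by (simp add: label_def)
      qed
    qed (auto simp: label_def)
    have "\<forall>i<n. \<exists>r s. (\<forall>j<n. c j \<le> r j \<and> r j \<le> c j + 1) \<and> (\<forall>j<n. c j \<le> s j \<and> s j \<le> c j + 1) \<and>
        pt p r \<in> V i \<and> pt p s \<notin> V i"
    proof (intro allI impI)
      fix i assume "i < n"
      then obtain r s where "\<forall>j<n. c j \<le> r j \<and> r j \<le> c j + 1" "\<forall>j<n. c j \<le> s j \<and> s j \<le> c j + 1"
        "label p r i \<noteq> label p s i" using rs by blast
      then show "\<exists>r s. (\<forall>j<n. c j \<le> r j \<and> r j \<le> c j + 1) \<and> (\<forall>j<n. c j \<le> s j \<and> s j \<le> c j + 1) \<and>
        pt p r \<in> V i \<and> pt p s \<notin> V i" unfolding label_def by (metis (lifting))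
    qed
    then obtain r s where "\<And>i. i < n \<Longrightarrow> (\<forall>j<n. c j \<le> r i j \<and> r i j \<le> c j + 1) \<and>
        (\<forall>j<n. c j \<le> s i j \<and> s i j \<le> c j + 1) \<and> pt p (r i) \<in> V i \<and> pt p (s i) \<notin> V i"
      by metis
    then have "cell p r s c" using c by (simp add: cell_def)
    then show ?thesis by blast
  qed
  then obtain r s c where "\<And>p. cell p (r p) (s p) (c p)" by metis
  then have c: "\<And>p i. i < n \<Longrightarrow> c p i < Suc p"
    and r: "\<And>p i j. i < n \<Longrightarrow> j < n \<Longrightarrow> c p j \<le> r p i j \<and> r p i j \<le> c p j + 1"
    and s: "\<And>p i j. i < n \<Longrightarrow> j < n \<Longrightarrow> c p j \<le> s p i j \<and> s p i j \<le> c p j + 1"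
    and rV: "\<And>p i. i < n \<Longrightarrow> pt p (r p i) \<in> V i" and sV: "\<And>p i. i < n \<Longrightarrow> pt p (s p i) \<notin> V i"
    unfolding cell_def by blast+
  have c_cube: "pt p (c p) \<in> cube n 1" for p using c[of _ p] by (intro pt_cube) (simp add: less_imp_le)
  have "seq_compact (cube n 1)" using compact_cube by (simp add: compact_eq_seq_compact_metric)
  then obtain z \<phi> where z: "z \<in> cube n 1" and \<phi>: "strict_mono \<phi>"
    and lim: "((\<lambda>p. pt p (c p)) \<circ> \<phi>) \<longlonglongrightarrow> z"
    by (rule seq_compactE[of "cube n 1" "\<lambda>p. pt p (c p)"]) (simp_all add: c_cube)
  \<comment> \<open>The mesh tends to \<open>0\<close>, so any choice of cell vertices has the same
    limit as the base corners \<open>c\<close>.\<close>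
  have conv: "(\<lambda>p. pt (\<phi> p) (t (\<phi> p))) \<longlonglongrightarrow> z"
    if t: "\<And>p j. j < n \<Longrightarrow> c p j \<le> t p j \<and> t p j \<le> c p j + 1" for t
  proof (rule tendsto_componentwise)
    fix j
    have 1: "(\<lambda>p. pt (\<phi> p) (c (\<phi> p)) j) \<longlonglongrightarrow> z j"
      using tendsto_component[OF lim, of j] by (simp add: comp_def)
    have "(\<lambda>p. 2 / real (Suc p)) \<longlonglongrightarrow> 0" using tendsto_mult_right_zero[OF LIMSEQ_inverse_real_of_nat, of 2] by (simp add: divide_inverse)
    from LIMSEQ_subseq_LIMSEQ[OF this \<phi>] have 2: "(\<lambda>p. 2 / real (Suc (\<phi> p))) \<longlonglongrightarrow> 0"
      by (simp add: comp_def)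
    have "(\<lambda>p. pt (\<phi> p) (t (\<phi> p)) j - pt (\<phi> p) (c (\<phi> p)) j) \<longlonglongrightarrow> 0"
    proof (rule Lim_null_comparison[OF _ 2], intro always_eventually allI)
      fix p
      show "norm (pt (\<phi> p) (t (\<phi> p)) j - pt (\<phi> p) (c (\<phi> p)) j) \<le> 2 / real (Suc (\<phi> p))"
      proof (cases "j < n")
        case True
        then have "\<bar>real (t (\<phi> p) j) - real (c (\<phi> p) j)\<bar> \<le> 1" using t[OF True, of "\<phi> p"] by linarith
        moreover have "pt (\<phi> p) (t (\<phi> p)) j - pt (\<phi> p) (c (\<phi> p)) j
            = 2 * (real (t (\<phi> p) j) - real (c (\<phi> p) j)) / real (Suc (\<phi> p))"
          using True by (simp add: pt_def diff_divide_distrib right_diff_distrib)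
        ultimately show ?thesis by (simp add: abs_mult divide_right_mono)
      qed (simp add: pt_def)
    qed
    from tendsto_add[OF this 1] show "(\<lambda>p. pt (\<phi> p) (t (\<phi> p)) j) \<longlonglongrightarrow> z j" by simp
  qed
  have near: "eventually (\<lambda>p. pt (\<phi> p) (t (\<phi> p)) \<in> W) sequentially"
    if W: "openin (top_of_set (cube n 1)) W" "z \<in> W"
      and t: "\<And>p j. j < n \<Longrightarrow> c p j \<le> t p j \<and> t p j \<le> c p j + 1" for W t
  proof -
    obtain O' where O': "open O'" "W = cube n 1 \<inter> O'" using W(1) by (auto simp: openin_open)
    have "t p i \<le> Suc p" if "i < n" for p i
      using t[OF that, of p] c[OF that, of p] by linarith
    then have "pt p (t p) \<in> cube n 1" for p by (simp add: pt_cube)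
    moreover have "eventually (\<lambda>p. pt (\<phi> p) (t (\<phi> p)) \<in> O') sequentially"
      by (rule topological_tendstoD[OF conv[OF t]]) (use O' W in auto)
    ultimately show ?thesis by (simp add: O')
  qed
  \<comment> \<open>Both sets are relatively open. If \<open>z\<close> were in \<open>U m\<close>,
    vertices \<open>r\<close> from \<open>V m\<close> would enter \<open>U m\<close>; if it were in
    \<open>V m\<close>, vertices \<open>s\<close> from outside \<open>V m\<close> would enter
    \<open>V m\<close>.\<close>
  have "z \<notin> U m \<and> z \<notin> V m" if m: "m < n" for m
  proof
    show "z \<notin> U m"
    proof
      assume "z \<in> U m"
      from near[OF U[OF m] this, of "\<lambda>p. r p m"] r[OF m]
      have "eventually (\<lambda>p. pt (\<phi> p) (r (\<phi> p) m) \<in> U m) sequentially" by blast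
      then obtain p where "pt (\<phi> p) (r (\<phi> p) m) \<in> U m" by (auto simp: eventually_sequentially)
      then show False using rV[OF m] disj[OF m] by blast
    qed
    show "z \<notin> V m"
    proof
      assume "z \<in> V m"
      from near[OF V[OF m] this, of "\<lambda>p. s p m"] s[OF m]
      have "eventually (\<lambda>p. pt (\<phi> p) (s (\<phi> p) m) \<in> V m) sequentially" by blast
      then obtain p where "pt (\<phi> p) (s (\<phi> p) m) \<in> V m" by (auto simp: eventually_sequentially)
      then show False using sV[OF m] by blast
    qed
  qed
  then show ?thesis using z by blast
qed

section \<open>Separation of compact sets and the chart at \<open>x\<close>\<close>

lemma compact_closed_dist_bound:
  fixes A B :: "'a::metric_space set"
  assumes "compact A" "closed B" "A \<inter> B = {}"
  shows "\<exists>d>0. \<forall>a\<in>A. \<forall>b\<in>B. d \<le> dist a b"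
proof (cases "A = {} \<or> B = {}")
  case True then show ?thesis by (intro exI[of _ 1]) auto
next
  case False
  have "continuous_on A (\<lambda>a. infdist a B)" by (intro continuous_intros)
  then obtain a where a: "a \<in> A" "\<And>a'. a' \<in> A \<Longrightarrow> infdist a B \<le> infdist a' B"
    using continuous_attains_inf[OF assms(1)] False by blast
  have "0 < infdist a B"
    using a(1) assms False by (intro infdist_pos_not_in_closed) auto
  moreover have "infdist a B \<le> dist a' b" if "a' \<in> A" "b \<in> B" for a' b
    using a(2)[OF that(1)] infdist_le[OF that(2), of a'] by linarith
  ultimately show ?thesis by blast
qed

lemma Euclidean_space_eq_top_of_set: "Euclidean_space n = top_of_set {x. \<forall>i\<ge>n. x i = 0}"
  by (simp add: Euclidean_space_def euclidean_product_topology)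

text \<open>Points within \<open>1 / (k + 1)\<close> of \<open>p\<close> in every coordinate
  converge to \<open>p\<close> in the product topology, so failure for every \<open>e\<close> would
  contradict continuity of \<open>g\<close>.\<close>

lemma cube_subset_of_continuous:
  fixes g :: "(nat \<Rightarrow> real) \<Rightarrow> 'a::topological_space"
  assumes E: "continuous_on E g" "p \<in> E" and W: "open W" "g p \<in> W"
  obtains e where "e > 0" "\<And>y. y \<in> E \<Longrightarrow> (\<And>i. \<bar>y i - p i\<bar> \<le> e) \<Longrightarrow> g y \<in> W"
proof -
  have "\<exists>e>0. \<forall>y\<in>E. (\<forall>i. \<bar>y i - p i\<bar> \<le> e) \<longrightarrow> g y \<in> W"
  proof (rule ccontr)
    assume "\<not> ?thesis"
    then have "\<forall>e>0. \<exists>y\<in>E. (\<forall>i. \<bar>y i - p i\<bar> \<le> e) \<and> g y \<notin> W" by blast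
    then have "\<forall>k::nat. \<exists>y\<in>E. (\<forall>i. \<bar>y i - p i\<bar> \<le> inverse (real (Suc k))) \<and> g y \<notin> W"
      by (simp del: of_nat_Suc)
    then obtain y where y: "\<And>k. y k \<in> E" "\<And>k i. \<bar>y k i - p i\<bar> \<le> inverse (real (Suc k))" "\<And>k. g (y k) \<notin> W"
      by metis
    have "y \<longlonglongrightarrow> p"
    proof (rule tendsto_componentwise)
      fix i
      have "(\<lambda>k. y k i - p i) \<longlonglongrightarrow> 0"
        by (rule Lim_null_comparison[OF _ LIMSEQ_inverse_real_of_nat]) (use y(2) in auto)
      then show "(\<lambda>k. y k i) \<longlonglongrightarrow> p i" by (simp add: LIM_zero_iff)
    qed
    then have "(\<lambda>k. g (y k)) \<longlonglongrightarrow> g p"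
      using E y(1) by (intro continuous_on_tendsto_compose[OF E(1)]) auto
    then have "eventually (\<lambda>k. g (y k) \<in> W) sequentially" using W by (rule topological_tendstoD)
    then show False using y(3) by (auto simp: eventually_sequentially)
  qed
  then show ?thesis using that by blast
qed

lemma locally_euclidean_chart:
  fixes S :: "'a::topological_space set"
  assumes nb: "nbhd_in S x N" and hom: "subtopology euclidean N homeomorphic_space Euclidean_space n"
  obtains h :: "(nat \<Rightarrow> real) \<Rightarrow> 'a" where "continuous_on (cube n 2) h" "inj_on h (cube n 2)"
    "h ` cube n 2 \<subseteq> S" "h (\<lambda>_. 0) = x" "\<And>r. r \<le> 2 \<Longrightarrow> openin (top_of_set S) (h ` open_cube n r)"
proof -
  define E where "E = {x :: nat \<Rightarrow> real. \<forall>i\<ge>n. x i = 0}"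
  obtain f g where fg: "homeomorphic_maps (top_of_set N) (top_of_set E) f g"
    using hom unfolding homeomorphic_space_def Euclidean_space_eq_top_of_set E_def by blast
  then have f: "continuous_on N f" "f ` N \<subseteq> E" and g: "continuous_on E g" "g ` E \<subseteq> N"
    and gf: "\<And>y. y \<in> N \<Longrightarrow> g (f y) = y" and fg: "\<And>y. y \<in> E \<Longrightarrow> f (g y) = y"
    by (auto simp: homeomorphic_maps_def)
  \<comment> \<open>\<open>N\<close> may fail to be open in \<open>S\<close>; the chart is shrunk
    into \<open>I\<close> so that relative openness carries over to \<open>S\<close>.\<close>
  define I where "I = (top_of_set S) interior_of N"
  have I: "openin (top_of_set S) I" "x \<in> I" "I \<subseteq> N" "N \<subseteq> S"
    using nb by (auto simp: nbhd_in_def I_def interior_of_subset)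
  obtain O' where O': "open O'" "I = S \<inter> O'" using I(1) by (auto simp: openin_open)
  define p where "p = f x"
  have p: "p \<in> E" "g p = x" using I f gf by (auto simp: p_def)
  obtain e where e: "e > 0" "\<And>y. y \<in> E \<Longrightarrow> (\<And>i. \<bar>y i - p i\<bar> \<le> e) \<Longrightarrow> g y \<in> O'"
    using cube_subset_of_continuous[OF g(1) p(1) O'(1)] I(2) O'(2) p(2) by blast
  \<comment> \<open>The factor \<open>e / 2\<close> fits the cube of half-width \<open>2\<close>
    into the box of half-width \<open>e\<close> around \<open>p\<close>.\<close>
  define s where "s y = (\<lambda>i. p i + e / 2 * y i)" for y :: "nat \<Rightarrow> real"
  have s_E: "s y \<in> E" if "y \<in> cube n r" for y r using that p(1) by (auto simp: s_def E_def cube_def)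
  define h where "h y = g (s y)" for y
  have h_I: "h y \<in> I" if y: "y \<in> cube n 2" for y
  proof -
    have "\<bar>s y i - p i\<bar> \<le> e" for i
    proof -
      have "\<bar>y i\<bar> \<le> 2" using y by (cases "i < n") (auto simp: cube_def)
      then have "e / 2 * \<bar>y i\<bar> \<le> e / 2 * 2" using e(1) by (intro mult_left_mono) auto
      then show ?thesis using e(1) by (simp add: s_def abs_mult)
    qed
    then have "g (s y) \<in> O'" using e(2) s_E[OF y] by blast
    moreover have "g (s y) \<in> S" using g(2) s_E[OF y] I(4) by blast
    ultimately show ?thesis by (simp add: h_def O'(2))
  qed
  have fh: "f (h y) = s y" if "y \<in> cube n 2" for y
    using fg s_E[OF that] by (simp add: h_def)
  have s_inv: "(s y i - p i) / (e / 2) = y i" for y i using e(1) by (simp add: s_def)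
  show ?thesis
  proof (rule that)
    have "continuous_on UNIV s" unfolding s_def
      by (intro continuous_on_coordinatewise_then_product continuous_intros continuous_on_product_coordinates)
    then show "continuous_on (cube n 2) h" unfolding h_def
      by (intro continuous_on_compose2[OF g(1)]) (auto intro: continuous_on_subset s_E)
    show "inj_on h (cube n 2)"
    proof (rule inj_onI)
      fix y y' assume "y \<in> cube n 2" "y' \<in> cube n 2" "h y = h y'"
      then have "s y = s y'" using fh by metis
      then show "y = y'" using s_inv by (metis ext)
    qed
    show "h ` cube n 2 \<subseteq> S" using h_I I by blast
    show "h (\<lambda>_. 0) = x" using p by (simp add: h_def s_def)
    fix r :: real assume r: "r \<le> 2"
    \<comment> \<open>Openness is read off from the inverse chart: the image is cut out of
      \<open>I\<close> by finitely many strict inequalities in the continuous coordinates of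
      \<open>f\<close>.\<close>
    have eq: "h ` open_cube n r = {z \<in> I. \<forall>i\<in>{..<n}. \<bar>(f z i - p i) / (e / 2)\<bar> < r}" (is "_ = ?R")
    proof
      show "h ` open_cube n r \<subseteq> ?R"
      proof
        fix z assume "z \<in> h ` open_cube n r"
        then obtain y where y: "y \<in> open_cube n r" "z = h y" by blast
        then have "y \<in> cube n 2" using r cube_subset(1)[of r 2 n] cube_subset(2)[of n r] by blast
        then have "z \<in> I" "f z = s y" using y(2) h_I fh by auto
        then show "z \<in> ?R" using y(1) unfolding mem_Collect_eq open_cube_def by (simp only: s_inv) simp
      qed
      show "?R \<subseteq> h ` open_cube n r"
      proof
        fix z assume z: "z \<in> ?R"
        define y where "y i = (f z i - p i) / (e / 2)" for i
        have fz: "f z \<in> E" "z \<in> N" using z I f(2) by auto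
        then have "y \<in> open_cube n r" using z p(1) by (auto simp: open_cube_def y_def E_def)
        moreover have "s y = f z" unfolding s_def y_def using e(1) by (intro ext) (simp add: field_simps)
        then have "h y = z" using gf fz by (simp add: h_def)
        ultimately show "z \<in> h ` open_cube n r" by blast
      qed
    qed
    have "continuous_on N (\<lambda>z. f z i)" for i
      using continuous_on_product_then_coordinatewise[OF f(1)] .
    then have "openin (top_of_set I) (I \<inter> (\<lambda>z. \<bar>(f z i - p i) / (e / 2)\<bar>) -` {..<r})" for i
      using I(3) e(1) by (intro continuous_openin_preimage_gen continuous_intros) (auto intro: continuous_on_subset)
    then have "openin (top_of_set I) {z \<in> I. \<bar>(f z i - p i) / (e / 2)\<bar> < r}" for i
      by (simp add: vimage_def Int_def)
    then have "openin (top_of_set I) ?R"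
    proof -
      assume *: "\<And>i. openin (top_of_set I) {z \<in> I. \<bar>(f z i - p i) / (e / 2)\<bar> < r}"
      have "openin (top_of_set I) (I \<inter> (\<Inter>i\<in>{..<n}. {z \<in> I. \<bar>(f z i - p i) / (e / 2)\<bar> < r}))"
        using * by (cases "n = 0") (auto intro!: openin_Int openin_INT)
      then show ?thesis by (rule back_subst[where P = "openin _"]) auto
    qed
    then show "openin (top_of_set S) (h ` open_cube n r)"
      unfolding eq using I(1) by (rule openin_trans)
  qed
qed


lemma compact_closed_dist_bound_uniform:
  fixes A B :: "nat \<Rightarrow> 'a::metric_space set"
  assumes "\<And>m. m < n \<Longrightarrow> compact (A m)" "\<And>m. m < n \<Longrightarrow> closed (B m)"
    "\<And>m. m < n \<Longrightarrow> A m \<inter> B m = {}"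
  shows "\<exists>d>0. \<forall>m<n. \<forall>a\<in>A m. \<forall>b\<in>B m. d \<le> dist a b"
  using assms
proof (induction n)
  case 0
  show ?case by (intro exI[of _ 1]) simp
next
  case (Suc n)
  obtain d where d: "d > 0" "\<forall>m<n. \<forall>a\<in>A m. \<forall>b\<in>B m. d \<le> dist a b"
    using Suc.IH Suc.prems by auto
  obtain d' where d': "d' > 0" "\<forall>a\<in>A n. \<forall>b\<in>B n. d' \<le> dist a b"
    using compact_closed_dist_bound[of "A n" "B n"] Suc.prems by auto
  show ?case
    using d d' by (intro exI[of _ "min d d'"]) (auto simp: less_Suc_eq intro: min.coboundedI1 min.coboundedI2)
qed

section \<open>Finite sets as parameters and as codes\<close>

lemma decidable_mem_finite:
  assumes "finite W" "rec_fn k f" shows "decidable k (\<lambda>xs. f xs \<in> W)"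
  using assms(1)
proof induction
  case (insert w W)
  then show ?case
    using decidable_disj[OF decidable_eq[OF assms(2) rec_fn_const[of k w]]] by simp
qed (simp add: decidable_const)

context enumerations
begin

lemma ce_pred_ex_le:
  assumes "ce_pred (Suc k) P" "rec_fn k f" shows "ce_pred k (\<lambda>xs. \<exists>i\<le>f xs. P (i # xs))"
proof -
  have "ce_pred (Suc k) (\<lambda>xs. xs ! 0 \<le> f (tl xs))"
    by (intro ce_pred_decidable decidable_le rec_fn_proj rec_fn_tl assms) simp
  from ce_pred_ex[OF ce_pred_conj[OF this assms(1)]] show ?thesis by simp
qed

text \<open>Meant for balls with labels: \<open>j\<close> and \<open>c\<close> are read in parallel
  at the same index \<open>a\<close>, so one ball may occur with several labels.\<close>

lemma finite_set_of_pairs_coded: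
  assumes "finite P" "P \<noteq> {}"
  obtains j c where "\<And>a. a \<le> \<eta> j \<Longrightarrow> (\<sigma> j a, \<sigma> c a) \<in> P"
    "\<And>p. p \<in> P \<Longrightarrow> \<exists>a\<le>\<eta> j. (\<sigma> j a, \<sigma> c a) = p"
proof -
  obtain ls where ls: "set ls = P" using finite_list[OF assms(1)] by blast
  then have "map fst ls \<noteq> []" "map snd ls \<noteq> []" using assms(2) by auto
  obtain j where j: "Suc (\<eta> j) = length ls" "\<And>a. a < length ls \<Longrightarrow> \<sigma> j a = fst (ls ! a)"
    using \<sigma>_surj[OF \<open>map fst ls \<noteq> []\<close>] by auto
  obtain c where c: "\<And>a. a < length ls \<Longrightarrow> \<sigma> c a = snd (ls ! a)"
    using \<sigma>_surj[OF \<open>map snd ls \<noteq> []\<close>] by auto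
  have le: "a \<le> \<eta> j \<longleftrightarrow> a < length ls" for a using j(1) by auto
  show ?thesis
  proof (rule that)
    fix a assume "a \<le> \<eta> j"
    then show "(\<sigma> j a, \<sigma> c a) \<in> P" using j(2) c ls by (auto simp: le)
  next
    fix p assume "p \<in> P"
    then obtain a where "a < length ls" "ls ! a = p" using ls by (auto simp: in_set_conv_nth)
    then show "\<exists>a\<le>\<eta> j. (\<sigma> j a, \<sigma> c a) = p" using j(2) c by (intro exI[of _ a]) (auto simp: le)
  qed
qed

lemma finite_set_coded:
  assumes "finite P" "P \<noteq> {}"
  obtains j where "idx \<sigma> \<eta> j = P"
proof -
  have "finite (P \<times> {0::nat})" "P \<times> {0::nat} \<noteq> {}" using assms by auto
  then obtain j c where "\<And>a. a \<le> \<eta> j \<Longrightarrow> (\<sigma> j a, \<sigma> c a) \<in> P \<times> {0}"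
    "\<And>p. p \<in> P \<times> {0} \<Longrightarrow> \<exists>a\<le>\<eta> j. (\<sigma> j a, \<sigma> c a) = p"
    by (rule finite_set_of_pairs_coded) blast
  then have "idx \<sigma> \<eta> j = P" unfolding idx_def by fastforce
  then show ?thesis by (rule that)
qed

end

section \<open>Covers by small rational balls, and certificates\<close>

context computable_metric
begin

abbreviation I_ball :: "nat \<Rightarrow> 'a set" where "I_ball b \<equiv> ball (ball_center b) (ball_radius b)"
abbreviation J_union :: "nat \<Rightarrow> 'a set" where "J_union j \<equiv> union_J \<alpha> q \<tau>1 \<tau>2 \<sigma> \<eta> j"

lemma J_union_iff: "y \<in> J_union j \<longleftrightarrow> (\<exists>a\<le>\<eta> j. y \<in> I_ball (\<sigma> j a))"
  by (auto simp: union_J_def idx_def ball_I_def)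

text \<open>Radius and position of the centre are bounded separately, so that a distance between two
  sets passes to a formal separation of balls near them.\<close>

definition near :: "'a set \<Rightarrow> real \<Rightarrow> nat \<Rightarrow> bool" where
  "near K \<delta> b \<longleftrightarrow> ball_radius b < \<delta> \<and> (\<exists>y\<in>K. dist (ball_center b) y < \<delta>)"

lemma near_ball_cover:
  assumes K: "compact K" and \<delta>: "\<delta> > 0"
  obtains B where "finite B" "K \<subseteq> (\<Union>b\<in>B. I_ball b)" "\<And>b. b \<in> B \<Longrightarrow> near K \<delta> b"
proof -
  have "\<exists>b. y \<in> I_ball b \<and> near K \<delta> b" if y: "y \<in> K" for y
  proof -
    obtain r where r: "0 < real_of_rat r" "real_of_rat r < \<delta>" using of_rat_dense[OF \<delta>] by blast
    have "y \<in> closure (range \<alpha>)" using cms by (simp add: computable_metric_space_def)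
    then obtain i where i: "dist (\<alpha> i) y < real_of_rat r"
      using r(1) unfolding closure_approachable by blast
    have "r \<in> range q" using good r(1) by (simp add: good_enumerations_def)
    then obtain i' where i': "q i' = r" by blast
    obtain b where b: "\<tau>1 b = i" "\<tau>2 b = i'" by (rule \<tau>_surj)
    have "near K \<delta> b" unfolding near_def using b i i' r y by force
    then show ?thesis using b i i' by (intro exI[of _ b]) simp
  qed
  then obtain f where f: "\<And>y. y \<in> K \<Longrightarrow> y \<in> I_ball (f y)" "\<And>y. y \<in> K \<Longrightarrow> near K \<delta> (f y)"
    by metis
  have "K \<subseteq> (\<Union>y\<in>K. I_ball (f y))" using f(1) by blast
  then obtain C where C: "C \<subseteq> K" "finite C" "K \<subseteq> (\<Union>y\<in>C. I_ball (f y))"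
    by (rule compactE_image[OF K open_ball])
  show ?thesis
    by (rule that[of "f ` C"]) (use C f(2) in auto)
qed

text \<open>Each ball uses up its tolerance twice, once for the offset of the centre and once for
  the radius.\<close>

lemma near_apart:
  assumes "near K d b" "near K' d' b'" "\<And>y y'. y \<in> K \<Longrightarrow> y' \<in> K' \<Longrightarrow> 2 * d + 2 * d' \<le> dist y y'"
  shows "ball_radius b + ball_radius b' < dist (ball_center b) (ball_center b')"
proof -
  obtain y where y: "y \<in> K" "dist (ball_center b) y < d" "ball_radius b < d"
    using assms(1) by (auto simp: near_def)
  obtain y' where y': "y' \<in> K'" "dist (ball_center b') y' < d'" "ball_radius b' < d'"
    using assms(2) by (auto simp: near_def)
  have "dist y y' \<le> dist (ball_center b) y + dist (ball_center b) (ball_center b') + dist (ball_center b') y'"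
    by (smt (verit) dist_commute dist_triangle)
  then show ?thesis using y y' assms(3)[OF y(1) y'(1)] by linarith
qed

lemma near_disjoint:
  assumes "near K d b" "\<And>y y'. y \<in> K \<Longrightarrow> y' \<in> K' \<Longrightarrow> 2 * d \<le> dist y y'"
  shows "I_ball b \<inter> K' = {}"
proof (rule ccontr)
  assume "I_ball b \<inter> K' \<noteq> {}"
  then obtain y' where y': "y' \<in> K'" "dist (ball_center b) y' < ball_radius b" by auto
  obtain y where y: "y \<in> K" "dist (ball_center b) y < d" "ball_radius b < d"
    using assms(1) by (auto simp: near_def)
  have "dist y y' \<le> dist (ball_center b) y + dist (ball_center b) y'"
    by (rule dist_triangle3)
  then show False using y y' assms(2)[OF y(1) y'(1)] by linarith
qed

text \<open>The data \<open>j\<close>, \<open>c\<close> describe a cover of \<open>S\<close> by rational balls \<open>\<sigma> j a\<close> with labels \<open>\<sigma> c a\<close>.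
  A label \<open>m < n\<close> or \<open>n + m\<close> puts the ball on the negative or positive side of the \<open>m\<close>-th axis; a ball
  with any other label lies off the unit cube (\<open>W\<close>) or inside the ball of radius \<open>2\<^sup>-\<^sup>k\<close> around \<open>\<alpha> i\<close>.
  The fixed pairs \<open>F\<close> force the two sides to contain the opposite faces. All clauses are
  semidecidable, and since the two sides alone cannot cover the cube, the last kind of ball meets \<open>S\<close>.\<close>

definition certificate ::
  "'a set \<Rightarrow> nat \<Rightarrow> nat set \<Rightarrow> (nat \<times> nat) set \<Rightarrow> nat \<Rightarrow> nat \<Rightarrow> nat \<Rightarrow> nat \<Rightarrow> bool" where
  "certificate S n W F j c i k \<longleftrightarrow> S \<subseteq> J_union j \<and>
    (\<forall>a\<le>\<eta> j. \<forall>a'\<le>\<eta> j. n \<le> \<sigma> c a \<or> \<sigma> c a' \<noteq> \<sigma> c a + n \<or>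
      ball_radius (\<sigma> j a) + ball_radius (\<sigma> j a') < dist (ball_center (\<sigma> j a)) (ball_center (\<sigma> j a'))) \<and>
    (\<forall>a\<le>\<eta> j. \<sigma> c a < 2 * n \<or> \<sigma> j a \<in> W \<or>
      dist (ball_center (\<sigma> j a)) (\<alpha> i) + ball_radius (\<sigma> j a) < (1/2) ^ k) \<and>
    (\<forall>p\<in>F. \<exists>a\<le>\<eta> j. \<sigma> j a = fst p \<and> \<sigma> c a = snd p)"

text \<open>Pulled back along \<open>h\<close>, the unions \<open>T m\<close> and
  \<open>T (n + m)\<close> are disjoint open sets containing opposite faces. Some \<open>h z\<close>
  escapes them all; a ball of the cover containing it has no side label and is not in
  \<open>W\<close>, hence lies within \<open>(1/2) ^ k\<close> of \<open>\<alpha> i\<close>.\<close>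

lemma certificate_sound:
  assumes cert: "certificate S n W F j c i k"
    and h: "continuous_on (cube n 1) h" "h ` cube n 1 \<subseteq> S"
    and W: "\<And>b. b \<in> W \<Longrightarrow> I_ball b \<inter> h ` cube n 1 = {}"
    and F: "\<And>m w. m < n \<Longrightarrow> w \<in> cube n 1 \<Longrightarrow> w m = -1 \<Longrightarrow> \<exists>b. (b, m) \<in> F \<and> h w \<in> I_ball b"
      "\<And>m w. m < n \<Longrightarrow> w \<in> cube n 1 \<Longrightarrow> w m = 1 \<Longrightarrow> \<exists>b. (b, n + m) \<in> F \<and> h w \<in> I_ball b"
  shows "\<exists>y\<in>S. dist (\<alpha> i) y < (1/2) ^ k"
proof -
  define T where "T l = (\<Union>a\<in>{a. a \<le> \<eta> j \<and> \<sigma> c a = l}. I_ball (\<sigma> j a))" for l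
  have T_open: "open (T l)" for l by (auto simp: T_def)
  have FT: "I_ball b \<subseteq> T l" if bl: "(b, l) \<in> F" for b l
  proof -
    obtain a where "a \<le> \<eta> j" "\<sigma> j a = b" "\<sigma> c a = l"
      using cert bl unfolding certificate_def by fastforce
    then show ?thesis unfolding T_def by blast
  qed
  have "\<exists>z\<in>cube n 1. \<forall>m<n. z \<notin> cube n 1 \<inter> h -` T m \<and> z \<notin> cube n 1 \<inter> h -` T (n + m)"
  proof (rule cube_not_covered)
    fix m assume m: "m < n"
    show "openin (top_of_set (cube n 1)) (cube n 1 \<inter> h -` T m)"
      "openin (top_of_set (cube n 1)) (cube n 1 \<inter> h -` T (n + m))"
      by (rule continuous_openin_preimage_gen[OF h(1) T_open])+
    have "I_ball (\<sigma> j a) \<inter> I_ball (\<sigma> j a') = {}"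
      if "a \<le> \<eta> j" "a' \<le> \<eta> j" "\<sigma> c a = m" "\<sigma> c a' = n + m" for a a'
    proof -
      have "ball_radius (\<sigma> j a) + ball_radius (\<sigma> j a') < dist (ball_center (\<sigma> j a)) (ball_center (\<sigma> j a'))"
        using cert that m unfolding certificate_def by (metis add.commute not_le)
      then show ?thesis by (intro disjoint_ballI) simp
    qed
    then show "(cube n 1 \<inter> h -` T m) \<inter> (cube n 1 \<inter> h -` T (n + m)) = {}"
      unfolding T_def by blast
  next
    fix m w assume m: "m < n" and w: "w \<in> cube n 1"
    show "w \<in> cube n 1 \<inter> h -` T m" if "w m = -1" using F(1)[OF m w that] FT w by blast
    show "w \<in> cube n 1 \<inter> h -` T (n + m)" if "w m = 1" using F(2)[OF m w that] FT w by blast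
  qed
  then obtain z where z: "z \<in> cube n 1" "\<And>m. m < n \<Longrightarrow> h z \<notin> T m" "\<And>m. m < n \<Longrightarrow> h z \<notin> T (n + m)"
    by blast
  have hz: "h z \<in> S" using z(1) h(2) by blast
  then obtain a where a: "a \<le> \<eta> j" "h z \<in> I_ball (\<sigma> j a)"
    using cert unfolding certificate_def by (meson J_union_iff subsetD)
  then have hT: "h z \<in> T (\<sigma> c a)" unfolding T_def by blast
  have "\<not> \<sigma> c a < 2 * n"
  proof
    assume "\<sigma> c a < 2 * n"
    then consider "\<sigma> c a < n" | m where "m < n" "\<sigma> c a = n + m"
      by (metis add_less_cancel_left le_Suc_ex mult_2 not_less)
    then show False using hT z(2,3) by cases auto
  qed
  moreover have "\<sigma> j a \<notin> W" using W[of "\<sigma> j a"] a(2) z(1) by blast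
  ultimately have "dist (ball_center (\<sigma> j a)) (\<alpha> i) + ball_radius (\<sigma> j a) < (1/2) ^ k"
    using cert a(1) unfolding certificate_def by blast
  moreover have "dist (\<alpha> i) (h z) \<le> dist (ball_center (\<sigma> j a)) (\<alpha> i) + dist (ball_center (\<sigma> j a)) (h z)"
    by (rule dist_triangle3)
  ultimately show ?thesis using hz a(2) by (intro bexI[of _ "h z"]) auto
qed

text \<open>The \<open>3/2\<close>-cube is split into a small box around \<open>z\<close> and, for
  each axis, the two parts where that coordinate is clearly below or clearly above that of
  \<open>z\<close>. Injectivity of \<open>h\<close> and compactness separate the images of opposite
  parts. As \<open>z\<close> is in the \<open>1/2\<close>-cube, these parts also keep their distance
  from the fixed balls at the opposite faces.\<close>

lemma certificate_exists:
  assumes h: "continuous_on (cube n 2) h" "inj_on h (cube n 2)"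
    and z: "z \<in> cube n (1/2)" "dist (\<alpha> i) (h z) < (1/2) ^ k"
    and W: "finite W" "S - h ` open_cube n (3/2) \<subseteq> (\<Union>b\<in>W. I_ball b)"
    and F: "finite F"
      "\<And>b l. (b, l) \<in> F \<Longrightarrow> l < 2 * n"
      "\<And>b m. (b, m) \<in> F \<Longrightarrow> m < n \<Longrightarrow> near (h ` {w \<in> cube n 1. w m = -1}) \<delta>0 b"
      "\<And>b m. (b, n + m) \<in> F \<Longrightarrow> m < n \<Longrightarrow> near (h ` {w \<in> cube n 1. w m = 1}) \<delta>0 b"
    and \<delta>0: "\<delta>0 > 0"
      "\<And>m w w'. m < n \<Longrightarrow> w \<in> cube n 1 \<Longrightarrow> w m = -1 \<Longrightarrow> w' \<in> cube n (3/2) \<Longrightarrow> -1/2 \<le> w' m \<Longrightarrow>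
        4 * \<delta>0 \<le> dist (h w) (h w')"
      "\<And>m w w'. m < n \<Longrightarrow> w \<in> cube n (3/2) \<Longrightarrow> w m \<le> 1/2 \<Longrightarrow> w' \<in> cube n 1 \<Longrightarrow> w' m = 1 \<Longrightarrow>
        4 * \<delta>0 \<le> dist (h w) (h w')"
  shows "\<exists>j c. certificate S n W F j c i k"
proof -
  have sub: "cube n r \<subseteq> cube n 2" if "r \<le> 2" for r using that by (rule cube_subset)
  have z2: "z \<in> cube n 2" "z \<in> cube n (3/2)" 
    using z(1) cube_subset(1)[of "1/2" 2 n] cube_subset(1)[of "1/2" "3/2" n] by auto
  define \<gamma> where "\<gamma> = (1/2) ^ k - dist (\<alpha> i) (h z)"
  have \<gamma>: "\<gamma> > 0" using z(2) by (simp add: \<gamma>_def)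
  obtain e where e: "e > 0" "\<And>w. w \<in> cube n 2 \<Longrightarrow> (\<And>m. \<bar>w m - z m\<bar> \<le> e) \<Longrightarrow> h w \<in> ball (h z) (\<gamma> / 2)"
    using cube_subset_of_continuous[OF h(1) z2(1) open_ball, of "h z" "\<gamma> / 2"] \<gamma> by auto
  define \<epsilon> where "\<epsilon> = min e (1/4)"
  have \<epsilon>: "\<epsilon> > 0" "\<epsilon> \<le> e" "\<epsilon> \<le> 1/4" using e(1) by (auto simp: \<epsilon>_def)
  define A where "A m = h ` (cube n (3/2) \<inter> {w. w m \<le> z m - \<epsilon>})" for m
  define B where "B m = h ` (cube n (3/2) \<inter> {w. z m + \<epsilon> \<le> w m})" for m
  define C where "C = h ` (cube n (3/2) \<inter> (\<Inter>m. {w. w m \<le> z m + \<epsilon>} \<inter> {w. z m - \<epsilon> \<le> w m}))"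
  have comp: "compact (h ` (cube n (3/2) \<inter> D))" if "closed D" for D
    using that sub[of "3/2"]
    by (intro compact_continuous_image compact_Int_closed compact_cube continuous_on_subset[OF h(1)]) auto
  have compA: "compact (A m)" and compB: "compact (B m)" for m
    unfolding A_def B_def by (intro comp closed_component_le closed_component_ge)+
  have compC: "compact C"
    unfolding C_def by (intro comp closed_INT ballI closed_Int closed_component_le closed_component_ge)
  have "A m \<inter> B m = {}" for m
  proof -
    have "(cube n (3/2) \<inter> {w. w m \<le> z m - \<epsilon>}) \<inter> (cube n (3/2) \<inter> {w. z m + \<epsilon> \<le> w m}) = {}"
      using \<epsilon>(1) by auto
    then show ?thesis unfolding A_def B_def
      using inj_on_image_Int[OF h(2), of "cube n (3/2) \<inter> {w. w m \<le> z m - \<epsilon>}" "cube n (3/2) \<inter> {w. z m + \<epsilon> \<le> w m}"]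
        sub[of "3/2"] by auto
  qed
  then have "\<exists>d>0. \<forall>m<n. \<forall>y\<in>A m. \<forall>y'\<in>B m. d \<le> dist y y'"
    by (intro compact_closed_dist_bound_uniform compA compact_imp_closed[OF compB])
  then obtain d where d: "d > 0" "\<And>m y y'. m < n \<Longrightarrow> y \<in> A m \<Longrightarrow> y' \<in> B m \<Longrightarrow> d \<le> dist y y'"
    by blast
  \<comment> \<open>\<open>d / 4\<close> separates balls near \<open>A m\<close> from balls near
    \<open>B m\<close>; \<open>\<delta>0\<close> keeps the new balls apart from those of
    \<open>F\<close>; \<open>\<gamma> / 4\<close> bounds radius plus offset by
    \<open>\<gamma> / 2\<close>, the other half of the slack being spent on the size of
    \<open>C\<close>.\<close>
  define \<delta> where "\<delta> = min (d / 4) (min \<delta>0 (\<gamma> / 4))"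
  have \<delta>: "\<delta> > 0" "4 * \<delta> \<le> d" "\<delta> \<le> \<delta>0" "4 * \<delta> \<le> \<gamma>" using d(1) \<delta>0(1) \<gamma> by (auto simp: \<delta>_def min_def)
  have "\<forall>m. \<exists>P. finite P \<and> A m \<subseteq> (\<Union>b\<in>P. I_ball b) \<and> (\<forall>b\<in>P. near (A m) \<delta> b)"
  proof
    fix m show "\<exists>P. finite P \<and> A m \<subseteq> (\<Union>b\<in>P. I_ball b) \<and> (\<forall>b\<in>P. near (A m) \<delta> b)"
      by (rule near_ball_cover[OF compA[of m] \<delta>(1)]) blast
  qed
  then obtain PA where PA: "\<And>m. finite (PA m)" "\<And>m. A m \<subseteq> (\<Union>b\<in>PA m. I_ball b)"
    "\<And>m b. b \<in> PA m \<Longrightarrow> near (A m) \<delta> b" by metis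
  have "\<forall>m. \<exists>P. finite P \<and> B m \<subseteq> (\<Union>b\<in>P. I_ball b) \<and> (\<forall>b\<in>P. near (B m) \<delta> b)"
  proof
    fix m show "\<exists>P. finite P \<and> B m \<subseteq> (\<Union>b\<in>P. I_ball b) \<and> (\<forall>b\<in>P. near (B m) \<delta> b)"
      by (rule near_ball_cover[OF compB[of m] \<delta>(1)]) blast
  qed
  then obtain PB where PB: "\<And>m. finite (PB m)" "\<And>m. B m \<subseteq> (\<Union>b\<in>PB m. I_ball b)"
    "\<And>m b. b \<in> PB m \<Longrightarrow> near (B m) \<delta> b" by metis
  obtain PC where PC: "finite PC" "C \<subseteq> (\<Union>b\<in>PC. I_ball b)" "\<And>b. b \<in> PC \<Longrightarrow> near C \<delta> b"
    using near_ball_cover[OF compC \<delta>(1)] by blast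
  \<comment> \<open>The label \<open>2 * n\<close> stands for no side at all.\<close>
  define P where "P = F \<union> (\<Union>m\<in>{..<n}. PA m \<times> {m}) \<union> (\<Union>m\<in>{..<n}. PB m \<times> {n + m}) \<union> (PC \<union> W) \<times> {2 * n}"
  \<comment> \<open>Ensures that \<open>P\<close> is nonempty, as coding requires.\<close>
  have "h z \<in> C" using z2(2) \<epsilon>(1) by (auto simp: C_def)
  then obtain b0 where "b0 \<in> PC" using PC(2) by blast
  then have "(b0, 2 * n) \<in> P" by (simp add: P_def)
  then have P_ne: "P \<noteq> {}" by auto
  have P_fin: "finite P" using F(1) W(1) PA(1) PB(1) PC(1) by (simp add: P_def)
  obtain j c where jc: "\<And>a. a \<le> \<eta> j \<Longrightarrow> (\<sigma> j a, \<sigma> c a) \<in> P"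
    "\<And>p. p \<in> P \<Longrightarrow> \<exists>a\<le>\<eta> j. (\<sigma> j a, \<sigma> c a) = p"
    using finite_set_of_pairs_coded[OF P_fin P_ne] by blast
  have "S \<subseteq> J_union j"
  proof
    fix y assume y: "y \<in> S"
    have "\<exists>p\<in>P. y \<in> I_ball (fst p)"
    proof (cases "y \<in> h ` open_cube n (3/2)")
      case False
      then obtain b where "b \<in> W" "y \<in> I_ball b" using W(2) y by blast
      then show ?thesis unfolding P_def by (intro bexI[of _ "(b, 2 * n)"]) auto
    next
      case True
      then obtain w where w: "w \<in> cube n (3/2)" "y = h w" using cube_subset(2) by blast
      \<comment> \<open>Both vanish there, so a point outside the small box deviates from
        \<open>z\<close> along a genuine axis.\<close>
      have out: "w m = z m" if "\<not> m < n" for m using that w(1) z(1) by (auto simp: cube_def)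
      show ?thesis
      proof (cases "\<forall>m. \<bar>w m - z m\<bar> \<le> \<epsilon>")
        case True
        then have "y \<in> C" using w by (auto simp: C_def abs_le_iff algebra_simps)
        then obtain b where "b \<in> PC" "y \<in> I_ball b" using PC(2) by blast
        then show ?thesis unfolding P_def by (intro bexI[of _ "(b, 2 * n)"]) auto
      next
        case False
        then obtain m where m: "\<not> \<bar>w m - z m\<bar> \<le> \<epsilon>" by blast
        then have mn: "m < n" using out[of m] \<epsilon>(1) by (cases "m < n") auto
        consider "w m \<le> z m - \<epsilon>" | "z m + \<epsilon> \<le> w m" using m by linarith
        then show ?thesis
        proof cases
          case 1
          then have "y \<in> A m" using w by (auto simp: A_def)
          then obtain b where "b \<in> PA m" "y \<in> I_ball b" using PA(2) by blast
          then show ?thesis using mn unfolding P_def by (intro bexI[of _ "(b, m)"]) auto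
        next
          case 2
          then have "y \<in> B m" using w by (auto simp: B_def)
          then obtain b where "b \<in> PB m" "y \<in> I_ball b" using PB(2) by blast
          then show ?thesis using mn unfolding P_def by (intro bexI[of _ "(b, n + m)"]) auto
        qed
      qed
    qed
    then show "y \<in> J_union j" unfolding J_union_iff using jc(2) by (metis fst_conv)
  qed
  moreover have "ball_radius b + ball_radius b' < dist (ball_center b) (ball_center b')"
    if bP: "(b, m) \<in> P" "(b', n + m) \<in> P" and m: "m < n" for b b' m
  proof -
    have zm: "\<bar>z m\<bar> \<le> 1/2" using z(1) m by (auto simp: cube_def)
    let ?L = "h ` {w \<in> cube n 1. w m = -1}" and ?R = "h ` {w \<in> cube n 1. w m = 1}"
    have b: "near ?L \<delta>0 b \<or> near (A m) \<delta> b" using bP(1) m F(3)[of b m] PA(3) by (auto simp: P_def)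
    have b': "near ?R \<delta>0 b' \<or> near (B m) \<delta> b'" using bP(2) m F(4)[of b' m] PB(3) by (auto simp: P_def)
    have 1: "4 * \<delta>0 \<le> dist y y'" if "y \<in> ?L" "y' \<in> ?R" for y y'
      using that \<delta>0(2)[OF m] cube_subset(1)[of 1 "3/2" n] by force
    have 2: "4 * \<delta>0 \<le> dist y y'" if yy: "y \<in> ?L" "y' \<in> B m" for y y'
    proof -
      obtain w w' where "w \<in> cube n 1" "w m = -1" "y = h w" "w' \<in> cube n (3/2)" "z m + \<epsilon> \<le> w' m" "y' = h w'"
        using yy by (auto simp: B_def)
      moreover from this have "-1/2 \<le> w' m" using zm \<epsilon>(1) by linarith
      ultimately show ?thesis using \<delta>0(2)[OF m] by blast
    qed
    have 3: "4 * \<delta>0 \<le> dist y y'" if yy: "y \<in> A m" "y' \<in> ?R" for y y'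
    proof -
      obtain w w' where "w' \<in> cube n 1" "w' m = 1" "y' = h w'" "w \<in> cube n (3/2)" "w m \<le> z m - \<epsilon>" "y = h w"
        using yy by (auto simp: A_def)
      moreover from this have "w m \<le> 1/2" using zm \<epsilon>(1) by linarith
      ultimately show ?thesis using \<delta>0(3)[OF m] by blast
    qed
    show ?thesis using b b'
    proof (elim disjE)
      assume "near ?L \<delta>0 b" "near ?R \<delta>0 b'"
      then show ?thesis by (rule near_apart) (use 1 in auto)
    next
      assume "near ?L \<delta>0 b" "near (B m) \<delta> b'"
      then show ?thesis by (rule near_apart) (use 2 \<delta>(3) in force)
    next
      assume "near (A m) \<delta> b" "near ?R \<delta>0 b'"
      then show ?thesis by (rule near_apart) (use 3 \<delta>(3) in force)
    next
      assume "near (A m) \<delta> b" "near (B m) \<delta> b'"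
      then show ?thesis by (rule near_apart) (use d(2)[OF m] \<delta>(2) in force)
    qed
  qed
  then have "\<forall>a\<le>\<eta> j. \<forall>a'\<le>\<eta> j. n \<le> \<sigma> c a \<or> \<sigma> c a' \<noteq> \<sigma> c a + n \<or>
      ball_radius (\<sigma> j a) + ball_radius (\<sigma> j a') < dist (ball_center (\<sigma> j a)) (ball_center (\<sigma> j a'))"
    using jc(1) by (metis add.commute not_le)
  moreover have "l < 2 * n \<or> b \<in> W \<or> dist (ball_center b) (\<alpha> i) + ball_radius b < (1/2) ^ k"
    if "(b, l) \<in> P" for b l
  proof -
    have "l < 2 * n \<or> b \<in> W \<or> b \<in> PC" using that F(2) by (auto simp: P_def)
    moreover have "dist (ball_center b) (\<alpha> i) + ball_radius b < (1/2) ^ k" if b: "b \<in> PC"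
    proof -
      obtain y where y: "y \<in> C" "dist (ball_center b) y < \<delta>" "ball_radius b < \<delta>"
        using PC(3)[OF b] by (auto simp: near_def)
      then obtain w where w: "w \<in> cube n (3/2)" "\<And>m. w m \<le> z m + \<epsilon>" "\<And>m. z m - \<epsilon> \<le> w m" "y = h w"
        by (auto simp: C_def)
      have "\<bar>w m - z m\<bar> \<le> e" for m using w(2,3)[of m] \<epsilon>(2) by linarith
      then have "dist (h z) y < \<gamma> / 2" using e(2)[of w] w(1,4) sub[of "3/2"] by auto
      moreover have "dist (ball_center b) (\<alpha> i) \<le> dist (ball_center b) y + dist (h z) y + dist (\<alpha> i) (h z)"
        by (smt (verit) dist_commute dist_triangle)
      moreover have "(1/2) ^ k = \<gamma> + dist (\<alpha> i) (h z)" by (simp add: \<gamma>_def)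
      ultimately show ?thesis using y \<delta>(4) by simp
    qed
    ultimately show ?thesis by blast
  qed
  then have "\<forall>a\<le>\<eta> j. \<sigma> c a < 2 * n \<or> \<sigma> j a \<in> W \<or>
      dist (ball_center (\<sigma> j a)) (\<alpha> i) + ball_radius (\<sigma> j a) < (1/2) ^ k"
    using jc(1) by blast
  moreover have "\<exists>a\<le>\<eta> j. \<sigma> j a = fst p \<and> \<sigma> c a = snd p" if "p \<in> F" for p
    using jc(2)[of p] that by (auto simp: P_def)
  ultimately have "certificate S n W F j c i k" unfolding certificate_def by blast
  then show ?thesis by blast
qed

end


section \<open>Semidecidability of the search condition\<close>

context computable_metric
begin

text \<open>\<open>n\<close>, \<open>W\<close> and \<open>F\<close> are built into the predicate:
  membership in \<open>W\<close> is decidable, and the quantifier over \<open>F\<close> is a finite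
  conjunction.\<close>

lemma ce_pred_certificate:
  assumes S: "ce_set {j. S \<subseteq> J_union j}" and W: "finite W" and F: "finite F"
  shows "ce_pred 4 (\<lambda>xs. certificate S n W F (xs ! 0) (xs ! 1) (xs ! 2) (xs ! 3))"
proof -
  note rec = rec_fn_\<sigma> rec_fn_\<eta> rec_fn_proj rec_fn_add rec_fn_const
  have 1: "ce_pred 4 (\<lambda>xs. S \<subseteq> J_union (xs ! 0))"
    using ce_pred_subst1[OF ce_pred_ce_set[OF S], of 4 "\<lambda>xs. xs ! 0"] by (simp add: rec_fn_proj)
  \<comment> \<open>argument list \<open>[a', a, j, c, i, k]\<close>\<close>
  have "ce_pred 6 (\<lambda>xs. n \<le> \<sigma> (xs ! 3) (xs ! 1) \<or> \<sigma> (xs ! 3) (xs ! 0) \<noteq> \<sigma> (xs ! 3) (xs ! 1) + n \<or>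
      ball_radius (\<sigma> (xs ! 2) (xs ! 1)) + ball_radius (\<sigma> (xs ! 2) (xs ! 0))
        < dist (ball_center (\<sigma> (xs ! 2) (xs ! 1))) (ball_center (\<sigma> (xs ! 2) (xs ! 0))))" (is "ce_pred 6 ?Q")
  proof (intro ce_pred_disj)
    show "ce_pred 6 (\<lambda>xs. n \<le> \<sigma> (xs ! 3) (xs ! 1))"
      by (intro ce_pred_decidable decidable_le rec) simp_all
    show "ce_pred 6 (\<lambda>xs. \<sigma> (xs ! 3) (xs ! 0) \<noteq> \<sigma> (xs ! 3) (xs ! 1) + n)"
      by (intro ce_pred_decidable decidable_not decidable_eq rec) simp_all
    show "ce_pred 6 (\<lambda>xs. ball_radius (\<sigma> (xs ! 2) (xs ! 1)) + ball_radius (\<sigma> (xs ! 2) (xs ! 0))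
        < dist (ball_center (\<sigma> (xs ! 2) (xs ! 1))) (ball_center (\<sigma> (xs ! 2) (xs ! 0))))"
      by (intro ce_pred_balls_apart rec) simp_all
  qed
  then have "ce_pred (Suc 5) ?Q" by simp
  moreover have "rec_fn 5 (\<lambda>xs. \<eta> (xs ! 1))" by (intro rec) simp
  ultimately have "ce_pred 5 (\<lambda>xs. \<forall>a'\<le>\<eta> (xs ! 1). ?Q (a' # xs))" by (rule ce_pred_all_le)
  then have "ce_pred (Suc 4) (\<lambda>xs. \<forall>a'\<le>\<eta> (xs ! 1). ?Q (a' # xs))" by simp
  moreover have eta: "rec_fn 4 (\<lambda>xs. \<eta> (xs ! 0))" by (intro rec) simp
  ultimately have 2: "ce_pred 4 (\<lambda>xs. \<forall>a\<le>\<eta> (xs ! 0). \<forall>a'\<le>\<eta> ((a # xs) ! 1). ?Q (a' # a # xs))"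
    by (rule ce_pred_all_le)
  \<comment> \<open>argument list \<open>[a, j, c, i, k]\<close>\<close>
  have "ce_pred 5 (\<lambda>xs. \<sigma> (xs ! 2) (xs ! 0) < 2 * n \<or> \<sigma> (xs ! 1) (xs ! 0) \<in> W \<or>
      dist (ball_center (\<sigma> (xs ! 1) (xs ! 0))) (\<alpha> (xs ! 3)) + ball_radius (\<sigma> (xs ! 1) (xs ! 0)) < (1/2) ^ (xs ! 4))"
      (is "ce_pred 5 ?R")
  proof (intro ce_pred_disj)
    show "ce_pred 5 (\<lambda>xs. \<sigma> (xs ! 2) (xs ! 0) < 2 * n)"
      by (intro ce_pred_decidable decidable_less rec) simp_all
    show "ce_pred 5 (\<lambda>xs. \<sigma> (xs ! 1) (xs ! 0) \<in> W)"
      by (intro ce_pred_decidable decidable_mem_finite W rec) simp_all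
    show "ce_pred 5 (\<lambda>xs. dist (ball_center (\<sigma> (xs ! 1) (xs ! 0))) (\<alpha> (xs ! 3)) + ball_radius (\<sigma> (xs ! 1) (xs ! 0))
        < (1/2) ^ (xs ! 4))"
      by (intro ce_pred_ball_inside rec) simp_all
  qed
  then have "ce_pred (Suc 4) ?R" by simp
  from ce_pred_all_le[OF this eta] have 3: "ce_pred 4 (\<lambda>xs. \<forall>a\<le>\<eta> (xs ! 0). ?R (a # xs))" .
  have "ce_pred 4 (\<lambda>xs. \<exists>a\<le>\<eta> (xs ! 0). \<sigma> ((a # xs) ! 1) ((a # xs) ! 0) = fst p \<and> \<sigma> ((a # xs) ! 2) ((a # xs) ! 0) = snd p)" for p
  proof (rule ce_pred_ex_le[OF _ eta, of "\<lambda>xs. \<sigma> (xs ! 1) (xs ! 0) = fst p \<and> \<sigma> (xs ! 2) (xs ! 0) = snd p"])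
    show "ce_pred (Suc 4) (\<lambda>xs. \<sigma> (xs ! 1) (xs ! 0) = fst p \<and> \<sigma> (xs ! 2) (xs ! 0) = snd p)"
      by (intro ce_pred_decidable decidable_conj decidable_eq rec) simp_all
  qed
  then have 4: "ce_pred 4 (\<lambda>xs. \<forall>p\<in>F. \<exists>a\<le>\<eta> (xs ! 0).
      \<sigma> ((a # xs) ! 1) ((a # xs) ! 0) = fst p \<and> \<sigma> ((a # xs) ! 2) ((a # xs) ! 0) = snd p)"
    by (rule ce_pred_Ball[OF F])
  from ce_pred_conj[OF 1 ce_pred_conj[OF 2 ce_pred_conj[OF 3 4]]] show ?thesis
    by (rule ce_pred_cong) (simp add: certificate_def)
qed

text \<open>First conjunct: the balls of radius \<open>2\<^sup>-\<^sup>k\<close> around the points of \<open>Lam \<alpha> \<sigma> \<eta> j'\<close> contain all points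
  of \<open>S\<close> off the balls in \<open>W\<close>. Second conjunct, with \<open>C\<close> the certificates above: each of them meets \<open>S\<close>.\<close>

lemma ce_pred_approximation:
  assumes S: "ce_set {j. S \<subseteq> J_union j}" and W: "finite W"
    and C: "ce_pred 4 (\<lambda>xs. C (xs ! 0) (xs ! 1) (xs ! 2) (xs ! 3))"
  shows "ce_pred 2 (\<lambda>xs. (\<exists>j. S \<subseteq> J_union j \<and> (\<forall>a\<le>\<eta> j. \<sigma> j a \<in> W \<or>
        ball_radius (\<sigma> j a) < (1/2) ^ (xs ! 0) \<and> (\<exists>i\<le>\<eta> (xs ! 1). \<tau>1 (\<sigma> j a) = \<sigma> (xs ! 1) i))) \<and>
      (\<forall>i\<le>\<eta> (xs ! 1). \<exists>j c. C j c (\<sigma> (xs ! 1) i) (xs ! 0)))"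
proof (rule ce_pred_conj)
  note rec = rec_fn_\<sigma> rec_fn_\<eta> rec_fn_proj rec_fn_\<tau>1
  \<comment> \<open>argument list \<open>[a, j, k, j']\<close>\<close>
  have "ce_pred 4 (\<lambda>xs. \<sigma> (xs ! 1) (xs ! 0) \<in> W \<or>
      ball_radius (\<sigma> (xs ! 1) (xs ! 0)) < (1/2) ^ (xs ! 2) \<and>
      (\<exists>i\<le>\<eta> (xs ! 3). \<tau>1 (\<sigma> ((i # xs) ! 2) ((i # xs) ! 1)) = \<sigma> ((i # xs) ! 4) ((i # xs) ! 0)))" (is "ce_pred 4 ?Q")
  proof (intro ce_pred_disj ce_pred_conj)
    show "ce_pred 4 (\<lambda>xs. \<sigma> (xs ! 1) (xs ! 0) \<in> W)"
      by (intro ce_pred_decidable decidable_mem_finite W rec) simp_all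
    show "ce_pred 4 (\<lambda>xs. ball_radius (\<sigma> (xs ! 1) (xs ! 0)) < (1/2) ^ (xs ! 2))"
      by (intro ce_pred_radius_less rec) simp_all
    have "ce_pred (Suc 4) (\<lambda>xs. \<tau>1 (\<sigma> (xs ! 2) (xs ! 1)) = \<sigma> (xs ! 4) (xs ! 0))"
      by (intro ce_pred_decidable decidable_eq rec) simp_all
    moreover have "rec_fn 4 (\<lambda>xs. \<eta> (xs ! 3))" by (intro rec) simp
    ultimately show "ce_pred 4 (\<lambda>xs. \<exists>i\<le>\<eta> (xs ! 3). \<tau>1 (\<sigma> ((i # xs) ! 2) ((i # xs) ! 1)) = \<sigma> ((i # xs) ! 4) ((i # xs) ! 0))"
      by (rule ce_pred_ex_le)
  qed
  then have "ce_pred (Suc 3) ?Q" by simp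
  moreover have "rec_fn 3 (\<lambda>xs. \<eta> (xs ! 0))" by (intro rec) simp
  ultimately have "ce_pred 3 (\<lambda>xs. \<forall>a\<le>\<eta> (xs ! 0). ?Q (a # xs))" by (rule ce_pred_all_le)
  moreover have "ce_pred 3 (\<lambda>xs. S \<subseteq> J_union (xs ! 0))"
    using ce_pred_subst1[OF ce_pred_ce_set[OF S], of 3 "\<lambda>xs. xs ! 0"] by (simp add: rec_fn_proj)
  ultimately have "ce_pred (Suc 2) (\<lambda>xs. S \<subseteq> J_union (xs ! 0) \<and> (\<forall>a\<le>\<eta> (xs ! 0). ?Q (a # xs)))"
    using ce_pred_conj by simp
  from ce_pred_ex[OF this] show "ce_pred 2 (\<lambda>xs. \<exists>j. S \<subseteq> J_union j \<and> (\<forall>a\<le>\<eta> j. \<sigma> j a \<in> W \<or>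
        ball_radius (\<sigma> j a) < (1/2) ^ (xs ! 0) \<and> (\<exists>i\<le>\<eta> (xs ! 1). \<tau>1 (\<sigma> j a) = \<sigma> (xs ! 1) i)))"
    by (rule ce_pred_cong) simp
  \<comment> \<open>argument list \<open>[j, c, i, k, j']\<close>\<close>
  have "ce_pred 5 (\<lambda>xs. (\<lambda>xs. C (xs ! 0) (xs ! 1) (xs ! 2) (xs ! 3))
      (map (\<lambda>g. g xs) [\<lambda>xs. xs ! 0, \<lambda>xs. xs ! 1, \<lambda>xs. \<sigma> (xs ! 4) (xs ! 2), \<lambda>xs. xs ! 3]))"
    by (rule ce_pred_subst) (use C in \<open>auto simp: rec_fn_\<sigma> rec_fn_proj eval_nat_numeral\<close>)
  then have "ce_pred (Suc 4) (\<lambda>xs. C (xs ! 0) (xs ! 1) (\<sigma> (xs ! 4) (xs ! 2)) (xs ! 3))"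
    by simp
  from ce_pred_ex[OF this] have "ce_pred (Suc 3) (\<lambda>xs. \<exists>j. C j (xs ! 0) (\<sigma> (xs ! 3) (xs ! 1)) (xs ! 2))"
    by simp
  from ce_pred_ex[OF this] have "ce_pred (Suc 2) (\<lambda>xs. \<exists>c j. C j c (\<sigma> (xs ! 2) (xs ! 0)) (xs ! 1))"
    by simp
  moreover have "rec_fn 2 (\<lambda>xs. \<eta> (xs ! 1))" by (intro rec) simp
  ultimately have "ce_pred 2 (\<lambda>xs. \<forall>i\<le>\<eta> (xs ! 1). \<exists>c j. C j c (\<sigma> ((i # xs) ! 2) ((i # xs) ! 0)) ((i # xs) ! 1))"
    by (rule ce_pred_all_le)
  then show "ce_pred 2 (\<lambda>xs. \<forall>i\<le>\<eta> (xs ! 1). \<exists>j c. C j c (\<sigma> (xs ! 1) i) (xs ! 0))"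
    by (rule ce_pred_cong) (simp, blast)
qed

section \<open>The fixed finite data and the search itself\<close>

text \<open>Relative openness makes the complement in \<open>S\<close> compact. It is at positive
  distance \<open>d\<close> from the image of the smaller cube, so balls with tolerance
  \<open>d / 2\<close> avoid that image.\<close>

lemma finite_balls_off_cube:
  assumes S: "compact S" and h: "continuous_on (cube n 2) h" "inj_on h (cube n 2)"
    and op: "openin (top_of_set S) (h ` open_cube n r)" and sr: "s < r" "r \<le> 2"
  obtains W where "finite W" "S - h ` open_cube n r \<subseteq> (\<Union>b\<in>W. I_ball b)"
    "\<And>b. b \<in> W \<Longrightarrow> I_ball b \<inter> h ` cube n s = {}"
proof -
  have "compact (S - h ` open_cube n r)"
    using op S by (auto simp: openin_open Diff_Int intro: compact_diff)
  moreover have "compact (h ` cube n s)"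
    using sr cube_subset(1)[of s 2 n]
    by (intro compact_continuous_image compact_cube continuous_on_subset[OF h(1)]) auto
  moreover have "(S - h ` open_cube n r) \<inter> h ` cube n s = {}"
    using cube_subset(3)[OF sr(1), of n] by blast
  ultimately obtain d where d: "d > 0" "\<forall>y\<in>S - h ` open_cube n r. \<forall>y'\<in>h ` cube n s. d \<le> dist y y'"
    using compact_closed_dist_bound compact_imp_closed by metis
  obtain W where W: "finite W" "S - h ` open_cube n r \<subseteq> (\<Union>b\<in>W. I_ball b)"
      "\<And>b. b \<in> W \<Longrightarrow> near (S - h ` open_cube n r) (d / 2) b"
    using near_ball_cover[of "S - h ` open_cube n r" "d / 2"] \<open>compact (S - h ` open_cube n r)\<close> d(1) by auto
  have "I_ball b \<inter> h ` cube n s = {}" if "b \<in> W" for b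
    using W(3)[OF that] by (rule near_disjoint) (use d(2) in auto)
  with W(1,2) show ?thesis by (rule that)
qed

text \<open>These balls are chosen before any centre or precision is known, so their tolerance must
  work for every \<open>z\<close> in the \<open>1/2\<close>-cube. Hence each face is separated from
  the whole half of the \<open>3/2\<close>-cube beyond \<open>-1/2\<close> or \<open>1/2\<close>,
  where any opposing part around such a \<open>z\<close> lies.\<close>

lemma face_balls:
  assumes h: "continuous_on (cube n 2) h" "inj_on h (cube n 2)"
  obtains F \<delta>0 where "finite F" "\<delta>0 > 0" "\<And>b l. (b, l) \<in> F \<Longrightarrow> l < 2 * n"
    "\<And>b m. (b, m) \<in> F \<Longrightarrow> m < n \<Longrightarrow> near (h ` {w \<in> cube n 1. w m = -1}) \<delta>0 b"
    "\<And>b m. (b, n + m) \<in> F \<Longrightarrow> m < n \<Longrightarrow> near (h ` {w \<in> cube n 1. w m = 1}) \<delta>0 b"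
    "\<And>m w. m < n \<Longrightarrow> w \<in> cube n 1 \<Longrightarrow> w m = -1 \<Longrightarrow> \<exists>b. (b, m) \<in> F \<and> h w \<in> I_ball b"
    "\<And>m w. m < n \<Longrightarrow> w \<in> cube n 1 \<Longrightarrow> w m = 1 \<Longrightarrow> \<exists>b. (b, n + m) \<in> F \<and> h w \<in> I_ball b"
    "\<And>m w w'. m < n \<Longrightarrow> w \<in> cube n 1 \<Longrightarrow> w m = -1 \<Longrightarrow> w' \<in> cube n (3/2) \<Longrightarrow> -1/2 \<le> w' m \<Longrightarrow>
        4 * \<delta>0 \<le> dist (h w) (h w')"
    "\<And>m w w'. m < n \<Longrightarrow> w \<in> cube n (3/2) \<Longrightarrow> w m \<le> 1/2 \<Longrightarrow> w' \<in> cube n 1 \<Longrightarrow> w' m = 1 \<Longrightarrow>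
        4 * \<delta>0 \<le> dist (h w) (h w')"
proof -
  define L where "L m = h ` {w \<in> cube n 1. w m = -1}" for m
  define R where "R m = h ` {w \<in> cube n 1. w m = 1}" for m
  define L' where "L' m = h ` {w \<in> cube n (3/2). w m \<le> 1/2}" for m
  define R' where "R' m = h ` {w \<in> cube n (3/2). -1/2 \<le> w m}" for m
  have comp: "compact (h ` {w \<in> cube n r. w \<in> D})" if "closed D" "r \<le> 2" for D r
  proof -
    have "compact (h ` (cube n r \<inter> D))"
      using that cube_subset(1)[of r 2 n]
      by (intro compact_continuous_image compact_Int_closed compact_cube continuous_on_subset[OF h(1)]) auto
    then show ?thesis by (simp add: Int_def)
  qed
  have closed_eq: "closed {w :: nat \<Rightarrow> real. w m = c}" for m c
    by (intro closed_Collect_eq continuous_on_product_coordinates continuous_on_const)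
  have cL: "compact (L m)" and cR: "compact (R m)" and cL': "compact (L' m)" and cR': "compact (R' m)" for m
    using comp[OF closed_eq[of m], of 1] comp[OF closed_component_le[of m "1/2"], of "3/2"]
      comp[OF closed_component_ge[of "-1/2" m], of "3/2"] unfolding L_def R_def L'_def R'_def by simp_all
  have disj: "h ` D \<inter> h ` D' = {}" if "D \<subseteq> cube n 2" "D' \<subseteq> cube n 2" "D \<inter> D' = {}" for D D'
    using inj_on_image_Int[OF h(2) that(1,2)] that(3) by simp
  have sub: "{w \<in> cube n r. Q w} \<subseteq> cube n 2" if "r \<le> 2" for r Q using cube_subset(1)[OF that] by blast
  have "L m \<inter> R' m = {}" "L' m \<inter> R m = {}" for m
    unfolding L_def R_def L'_def R'_def by (intro disj sub; auto)+
  then obtain d1 d2 where d1: "d1 > 0" "\<forall>m<n. \<forall>y\<in>L m. \<forall>y'\<in>R' m. d1 \<le> dist y y'"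
    and d2: "d2 > 0" "\<forall>m<n. \<forall>y\<in>L' m. \<forall>y'\<in>R m. d2 \<le> dist y y'"
    using compact_closed_dist_bound_uniform[of n L R', OF cL compact_imp_closed[OF cR']]
      compact_closed_dist_bound_uniform[of n L' R, OF cL' compact_imp_closed[OF cR]] by metis
  \<comment> \<open>Two balls of tolerance \<open>\<delta>0\<close> need their reference sets
    \<open>4 * \<delta>0\<close> apart.\<close>
  define \<delta>0 where "\<delta>0 = min d1 d2 / 4"
  have \<delta>0: "\<delta>0 > 0" "4 * \<delta>0 \<le> d1" "4 * \<delta>0 \<le> d2" using d1(1) d2(1) by (auto simp: \<delta>0_def)
  have ex: "\<exists>P. finite P \<and> K \<subseteq> (\<Union>b\<in>P. I_ball b) \<and> (\<forall>b\<in>P. near K \<delta>0 b)" if K: "compact K" for K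
    by (rule near_ball_cover[OF K \<delta>0(1)]) blast
  obtain PL where PL: "\<And>m. finite (PL m)" "\<And>m. L m \<subseteq> (\<Union>b\<in>PL m. I_ball b)"
    "\<And>m b. b \<in> PL m \<Longrightarrow> near (L m) \<delta>0 b" using ex[OF cL] by metis
  obtain PR where PR: "\<And>m. finite (PR m)" "\<And>m. R m \<subseteq> (\<Union>b\<in>PR m. I_ball b)"
    "\<And>m b. b \<in> PR m \<Longrightarrow> near (R m) \<delta>0 b" using ex[OF cR] by metis
  define F where "F = (\<Union>m\<in>{..<n}. PL m \<times> {m}) \<union> (\<Union>m\<in>{..<n}. PR m \<times> {n + m})"
  show ?thesis
  proof (rule that[of F \<delta>0])
    show "finite F" using PL(1) PR(1) by (simp add: F_def)
    show "\<delta>0 > 0" by (rule \<delta>0)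
    show "l < 2 * n" if "(b, l) \<in> F" for b l using that by (auto simp: F_def)
    fix m assume m: "m < n"
    show "near (h ` {w \<in> cube n 1. w m = -1}) \<delta>0 b" if "(b, m) \<in> F" for b
      using that m PL(3) by (auto simp: F_def L_def)
    show "near (h ` {w \<in> cube n 1. w m = 1}) \<delta>0 b" if "(b, n + m) \<in> F" for b
      using that m PR(3) by (auto simp: F_def R_def)
    show "\<exists>b. (b, m) \<in> F \<and> h w \<in> I_ball b" if w: "w \<in> cube n 1" "w m = -1" for w
    proof -
      have "h w \<in> L m" using w by (auto simp: L_def)
      then obtain b where "b \<in> PL m" "h w \<in> I_ball b" using PL(2) by blast
      then show ?thesis using m by (intro exI[of _ b]) (simp add: F_def)
    qed
    show "\<exists>b. (b, n + m) \<in> F \<and> h w \<in> I_ball b" if w: "w \<in> cube n 1" "w m = 1" for w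
    proof -
      have "h w \<in> R m" using w by (auto simp: R_def)
      then obtain b where "b \<in> PR m" "h w \<in> I_ball b" using PR(2) by blast
      then show ?thesis using m by (intro exI[of _ b]) (simp add: F_def)
    qed
    fix w w'
    show "4 * \<delta>0 \<le> dist (h w) (h w')"
      if "w \<in> cube n 1" "w m = -1" "w' \<in> cube n (3/2)" "-1/2 \<le> w' m"
    proof -
      have "h w \<in> L m" "h w' \<in> R' m" using that by (auto simp: L_def R'_def)
      then show ?thesis using d1(2) m \<delta>0(2) by (meson order_trans)
    qed
    show "4 * \<delta>0 \<le> dist (h w) (h w')"
      if "w \<in> cube n (3/2)" "w m \<le> 1/2" "w' \<in> cube n 1" "w' m = 1"
    proof -
      have "h w \<in> L' m" "h w' \<in> R m" using that by (auto simp: L'_def R_def)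
      then show ?thesis using d2(2) m \<delta>0(3) by (meson order_trans)
    qed
  qed
qed

theorem computable_up_to_cube:
  assumes S: "compact S" "ce_set {j. S \<subseteq> J_union j}"
    and h: "continuous_on (cube n 2) h" "inj_on h (cube n 2)" "h ` cube n 2 \<subseteq> S"
    and op: "\<And>r. r \<le> 2 \<Longrightarrow> openin (top_of_set S) (h ` open_cube n r)"
  shows "computable_up_to \<alpha> \<sigma> \<eta> (h ` cube n (1/4)) S"
proof -
  obtain W where W: "finite W" "S - h ` open_cube n (3/2) \<subseteq> (\<Union>b\<in>W. I_ball b)"
    "\<And>b. b \<in> W \<Longrightarrow> I_ball b \<inter> h ` cube n 1 = {}"
    by (rule finite_balls_off_cube[OF S(1) h(1,2) op[of "3/2"], of 1]) auto
  obtain W' where W': "finite W'" "S - h ` open_cube n (1/2) \<subseteq> (\<Union>b\<in>W'. I_ball b)"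
    "\<And>b. b \<in> W' \<Longrightarrow> I_ball b \<inter> h ` cube n (1/4) = {}"
    by (rule finite_balls_off_cube[OF S(1) h(1,2) op[of "1/2"], of "1/4"]) auto
  obtain F \<delta>0 where F: "finite F" "\<delta>0 > 0" "\<And>b l. (b, l) \<in> F \<Longrightarrow> l < 2 * n"
    "\<And>b m. (b, m) \<in> F \<Longrightarrow> m < n \<Longrightarrow> near (h ` {w \<in> cube n 1. w m = -1}) \<delta>0 b"
    "\<And>b m. (b, n + m) \<in> F \<Longrightarrow> m < n \<Longrightarrow> near (h ` {w \<in> cube n 1. w m = 1}) \<delta>0 b"
    "\<And>m w. m < n \<Longrightarrow> w \<in> cube n 1 \<Longrightarrow> w m = -1 \<Longrightarrow> \<exists>b. (b, m) \<in> F \<and> h w \<in> I_ball b"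
    "\<And>m w. m < n \<Longrightarrow> w \<in> cube n 1 \<Longrightarrow> w m = 1 \<Longrightarrow> \<exists>b. (b, n + m) \<in> F \<and> h w \<in> I_ball b"
    "\<And>m w w'. m < n \<Longrightarrow> w \<in> cube n 1 \<Longrightarrow> w m = -1 \<Longrightarrow> w' \<in> cube n (3/2) \<Longrightarrow> -1/2 \<le> w' m \<Longrightarrow>
        4 * \<delta>0 \<le> dist (h w) (h w')"
    "\<And>m w w'. m < n \<Longrightarrow> w \<in> cube n (3/2) \<Longrightarrow> w m \<le> 1/2 \<Longrightarrow> w' \<in> cube n 1 \<Longrightarrow> w' m = 1 \<Longrightarrow>
        4 * \<delta>0 \<le> dist (h w) (h w')"
    by (rule face_balls[OF h(1,2)]) blast
  let ?C = "certificate S n W F"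
  define Q where "Q k j' \<longleftrightarrow> (\<exists>j. S \<subseteq> J_union j \<and> (\<forall>a\<le>\<eta> j. \<sigma> j a \<in> W' \<or>
        ball_radius (\<sigma> j a) < (1/2) ^ k \<and> (\<exists>i\<le>\<eta> j'. \<tau>1 (\<sigma> j a) = \<sigma> j' i))) \<and>
      (\<forall>i\<le>\<eta> j'. \<exists>j c. ?C j c (\<sigma> j' i) k)" for k j'
  have Q_ce: "ce_pred 2 (\<lambda>xs. Q (xs ! 0) (xs ! 1))"
    unfolding Q_def by (rule ce_pred_approximation[OF S(2) W'(1) ce_pred_certificate[OF S(2) W(1) F(1)]])
  \<comment> \<open>Witness: the centres of a fine cover \<open>P\<close> of the
    \<open>1/2\<close>-cube. Together with \<open>W'\<close> it covers \<open>S\<close>, and each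
    centre is within \<open>(1/2) ^ k\<close> of some \<open>h z\<close> with \<open>z\<close> in
    that cube, so it has a certificate.\<close>
  have Q_ex: "\<exists>j'. Q k j'" for k
  proof -
    have "compact (h ` cube n (1/2))"
      using cube_subset(1)[of "1/2" 2 n]
      by (intro compact_continuous_image compact_cube continuous_on_subset[OF h(1)]) auto
    then obtain P where P: "finite P" "h ` cube n (1/2) \<subseteq> (\<Union>b\<in>P. I_ball b)"
      "\<And>b. b \<in> P \<Longrightarrow> near (h ` cube n (1/2)) ((1/2) ^ k) b"
      using near_ball_cover[of "h ` cube n (1/2)" "(1/2) ^ k"] by auto
    have "(\<lambda>_. 0) \<in> cube n (1/2)" by (simp add: cube_def)
    then have P_ne: "P \<noteq> {}" using P(2) by blast
    obtain j' where j': "idx \<sigma> \<eta> j' = \<tau>1 ` P"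
      by (rule finite_set_coded[of "\<tau>1 ` P"]) (use P(1) P_ne in auto)
    obtain j where j: "idx \<sigma> \<eta> j = P \<union> W'"
      by (rule finite_set_coded[of "P \<union> W'"]) (use P(1) P_ne W'(1) in auto)
    have "S \<subseteq> J_union j"
    proof
      fix y assume y: "y \<in> S"
      have "\<exists>b\<in>P \<union> W'. y \<in> I_ball b"
      proof (cases "y \<in> h ` open_cube n (1/2)")
        case True
        then have "y \<in> h ` cube n (1/2)" using cube_subset(2) by blast
        then show ?thesis using P(2) by blast
      next
        case False
        then show ?thesis using W'(2) y by blast
      qed
      then show "y \<in> J_union j" unfolding union_J_def ball_I_def j by blast
    qed
    moreover have "\<forall>a\<le>\<eta> j. \<sigma> j a \<in> W' \<or> ball_radius (\<sigma> j a) < (1/2) ^ k \<and> (\<exists>i\<le>\<eta> j'. \<tau>1 (\<sigma> j a) = \<sigma> j' i)"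
    proof (intro allI impI)
      fix a assume "a \<le> \<eta> j"
      then have a: "\<sigma> j a \<in> P \<union> W'" using j by (auto simp: idx_def)
      have "\<exists>i\<le>\<eta> j'. \<tau>1 b = \<sigma> j' i" if "b \<in> P" for b
      proof -
        have "\<tau>1 b \<in> idx \<sigma> \<eta> j'" using that j' by blast
        then show ?thesis by (auto simp: idx_def)
      qed
      then show "\<sigma> j a \<in> W' \<or> ball_radius (\<sigma> j a) < (1/2) ^ k \<and> (\<exists>i\<le>\<eta> j'. \<tau>1 (\<sigma> j a) = \<sigma> j' i)"
        using a P(3)[of "\<sigma> j a"] unfolding near_def by blast
    qed
    moreover have "\<exists>j c. ?C j c (\<sigma> j' i) k" if "i \<le> \<eta> j'" for i
    proof -
      have "\<sigma> j' i \<in> \<tau>1 ` P" using that j' by (auto simp: idx_def)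
      then obtain b where b: "b \<in> P" "\<sigma> j' i = \<tau>1 b" by blast
      then obtain z where z: "z \<in> cube n (1/2)" "dist (\<alpha> (\<sigma> j' i)) (h z) < (1/2) ^ k"
        using P(3)[OF b(1)] by (auto simp: near_def)
      show ?thesis
        by (rule certificate_exists[OF h(1,2) z W(1,2) F(1,3,4,5,2,8,9)])
    qed
    ultimately show ?thesis unfolding Q_def by blast
  qed
  have "\<exists>f. computable1 f \<and> (\<forall>k. Q k (f k))"
    using ce_pred_uniformization[OF Q_ce] Q_ex by simp
  then obtain f where f: "computable1 f" "\<And>k. Q k (f k)" by blast
  have sub: "cube n r \<subseteq> cube n 2" if "r \<le> 2" for r using that by (rule cube_subset)
  have "prec_eps (h ` cube n (1/4)) ((1/2) ^ k) (Lam \<alpha> \<sigma> \<eta> (f k))" for k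
    unfolding prec_eps_def
  proof
    fix y assume y: "y \<in> h ` cube n (1/4)"
    obtain j where j: "S \<subseteq> J_union j" "\<forall>a\<le>\<eta> j. \<sigma> j a \<in> W' \<or>
        ball_radius (\<sigma> j a) < (1/2) ^ k \<and> (\<exists>i\<le>\<eta> (f k). \<tau>1 (\<sigma> j a) = \<sigma> (f k) i)"
      using f(2)[of k] unfolding Q_def by blast
    have "y \<in> S" using y h(3) sub[of "1/4"] by auto
    then obtain a where a: "a \<le> \<eta> j" "y \<in> I_ball (\<sigma> j a)" using j(1) J_union_iff by blast
    \<comment> \<open>Balls of \<open>W'\<close> miss the \<open>1/4\<close>-cube, so the ball found
      around \<open>y\<close> is a small one with a listed centre.\<close>
    have "\<sigma> j a \<notin> W'" using W'(3) a(2) y by blast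
    then obtain i where i: "i \<le> \<eta> (f k)" "\<tau>1 (\<sigma> j a) = \<sigma> (f k) i" and r: "ball_radius (\<sigma> j a) < (1/2) ^ k"
      using j(2) a(1) by blast
    have "dist y (\<alpha> (\<sigma> (f k) i)) < (1/2) ^ k"
      using a(2) r i(2) by (simp add: dist_commute)
    then show "\<exists>b\<in>Lam \<alpha> \<sigma> \<eta> (f k). dist y b < (1/2) ^ k"
      using i(1) by (auto simp: Lam_def idx_def)
  qed
  moreover have "prec_eps (Lam \<alpha> \<sigma> \<eta> (f k)) ((1/2) ^ k) S" for k
    unfolding prec_eps_def
  proof
    fix y assume "y \<in> Lam \<alpha> \<sigma> \<eta> (f k)"
    then obtain i where i: "i \<le> \<eta> (f k)" "y = \<alpha> (\<sigma> (f k) i)" by (auto simp: Lam_def idx_def)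
    then obtain j c where C: "?C j c (\<sigma> (f k) i) k" using f(2)[of k] unfolding Q_def by blast
    have h1: "continuous_on (cube n 1) h" "h ` cube n 1 \<subseteq> S"
      using continuous_on_subset[OF h(1)] h(3) sub[of 1] by auto
    show "\<exists>b\<in>S. dist y b < (1/2) ^ k"
      unfolding i(2) by (rule certificate_sound[OF C h1 W(3) F(6,7)])
  qed
  ultimately show ?thesis unfolding computable_up_to_def using f(1) by blast
qed

end


theorem theorem5p6:
  fixes \<alpha> :: "nat \<Rightarrow> 'a::metric_space"
    and q :: "nat \<Rightarrow> rat" and \<tau>1 \<tau>2 :: "nat \<Rightarrow> nat"
    and \<sigma> :: "nat \<Rightarrow> nat \<Rightarrow> nat" and \<eta> :: "nat \<Rightarrow> nat"
    and S :: "'a set" and x :: 'a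
  assumes "computable_metric_space \<alpha>"
    and "good_enumerations q \<tau>1 \<tau>2 \<sigma> \<eta>"
    and "semicomputable_compact \<alpha> q \<tau>1 \<tau>2 \<sigma> \<eta> S"
    and "x \<in> S"
    and "\<exists>N n. nbhd_in S x N \<and> subtopology euclidean N homeomorphic_space Euclidean_space n"
  shows "\<exists>N. nbhd_in S x N \<and> computable_up_to \<alpha> \<sigma> \<eta> N S"
proof -
  interpret computable_metric q \<tau>1 \<tau>2 \<sigma> \<eta> \<alpha>
    using assms(1,2) by unfold_locales
  have S: "compact S" "ce_set {j. S \<subseteq> union_J \<alpha> q \<tau>1 \<tau>2 \<sigma> \<eta> j}"
    using assms(3) by (simp_all add: semicomputable_compact_def)
  obtain N n where "nbhd_in S x N" "subtopology euclidean N homeomorphic_space Euclidean_space n"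
    using assms(5) by blast
  then obtain h where h: "continuous_on (cube n 2) h" "inj_on h (cube n 2)" "h ` cube n 2 \<subseteq> S"
    and hx: "h (\<lambda>_. 0) = x" and op: "\<And>r. r \<le> 2 \<Longrightarrow> openin (top_of_set S) (h ` open_cube n r)"
    by (rule locally_euclidean_chart) blast
  \<comment> \<open>The image of the open cube is relatively open and contains \<open>x\<close>, so
    it witnesses that \<open>x\<close> is interior.\<close>
  have "h ` open_cube n (1/4) \<subseteq> (top_of_set S) interior_of (h ` cube n (1/4))"
    using cube_subset(2) by (intro interior_of_maximal op image_mono) auto
  moreover have "x \<in> h ` open_cube n (1/4)"
    using hx by (intro image_eqI[of _ _ "\<lambda>_. 0"]) (auto simp: open_cube_def)
  moreover have "h ` cube n (1/4) \<subseteq> S"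
    using h(3) cube_subset(1)[of "1/4" 2 n] by auto
  ultimately have "nbhd_in S x (h ` cube n (1/4))" by (auto simp: nbhd_in_def)
  then show ?thesis using computable_up_to_cube[OF S h op] by blast
qed

end
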